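(* Let $T_k$ ($k\ge 2$) be the triangular grid with $k$ vertices on each side, and let $s(T_k)$ denote its spanning tree congestion. Then $$s(T_{3n})=4n \ \text{ and } \ s(T_{3n+1})=4n\quad\text{for all integers } n\ge 1,\qquad s(T_{3n+2})=4n+2\quad\text{for all integers } n\ge 0.$$
   Context: **Spanning tree congestion.** Let $T$ be a spanning tree of a finite connected graph $G$ ($T$ is a subgraph of $G$). For each edge $e$ of $T$ let $A_e,B_e$ be the vertex sets of the two components of $T-e$, and let $e_G(A_e,B_e)$ be the number of edges of $G$ with one end vertex in $A_e$ and the other in $B_e$. Put $\mathrm{ec}(G:T)=\max_{e\in E(T)}e_G(A_e,B_e)$ and $s(G)=\min\{\mathrm{ec}(G:T): T \text{ is a spanning tree of } G\}$. **Triangular grid.** For $k\ge 2$, the graph $T_k$ is obtained by dividing each side of a triangle into $k-1$ equal pieces and joining the corresponding subdivision points of different sides of the triangle by line segments (parallel to the sides). All intersections of line segments (including the corners and subdivision points) are vertices, there are no other vertices, and edges are the segments between consecutive vertices. Equivalently, the vertices of $T_k$ are the triples $(a,b,c)$ of nonnegative integers with $a+b+c=k-1$, and two vertices are adjacent if and only if their difference is a permutation of $(1,-1,0)$. Thus $T_2$ is a triangle. *)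

theory Defs
  imports Main
begin

text \<open>
  A graph is a pair of a vertex set and an edge set, an edge being the set of its two end
  vertices. (The notion of tree in the AFP entry Graph_Theory is about directed cycles, so that
  every acyclic orientation of a connected graph is a tree there; it is not used here.)
\<close>

type_synonym 'a graph = "'a set \<times> 'a set set"

abbreviation verts :: "'a graph \<Rightarrow> 'a set" where
  "verts G \<equiv> fst G"

abbreviation edges :: "'a graph \<Rightarrow> 'a set set" where
  "edges G \<equiv> snd G"

definition simple_graph :: "'a graph \<Rightarrow> bool" where
  "simple_graph G \<longleftrightarrow> (\<forall>e\<in>edges G. e \<subseteq> verts G \<and> card e = 2)"

definition subgraph :: "'a graph \<Rightarrow> 'a graph \<Rightarrow> bool" where
  "subgraph H G \<longleftrightarrow> simple_graph H \<and> verts H \<subseteq> verts G \<and> edges H \<subseteq> edges G"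

definition adj_rel :: "'a graph \<Rightarrow> 'a rel" where
  "adj_rel G = {(u, v). {u, v} \<in> edges G}"

definition components :: "'a graph \<Rightarrow> 'a set set" where
  "components G = verts G // (adj_rel G)\<^sup>*"

definition connected_graph :: "'a graph \<Rightarrow> bool" where
  "connected_graph G \<longleftrightarrow>
     verts G \<noteq> {} \<and> (\<forall>u\<in>verts G. \<forall>v\<in>verts G. (u, v) \<in> (adj_rel G)\<^sup>*)"

definition is_cycle :: "'a graph \<Rightarrow> 'a list \<Rightarrow> bool" where
  "is_cycle G p \<longleftrightarrow> length p \<ge> 3 \<and> distinct p \<and>
     (\<forall>i<length p. {p ! i, p ! (Suc i mod length p)} \<in> edges G)"

definition tree :: "'a graph \<Rightarrow> bool" where
  "tree T \<longleftrightarrow> simple_graph T \<and> connected_graph T \<and> (\<nexists>p. is_cycle T p)"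

definition spanning_tree :: "'a graph \<Rightarrow> 'a graph \<Rightarrow> bool" where
  "spanning_tree T G \<longleftrightarrow> tree T \<and> subgraph T G \<and> verts T = verts G"

definition delete_edge :: "'a graph \<Rightarrow> 'a set \<Rightarrow> 'a graph" where
  "delete_edge G e = (verts G, edges G - {e})"

definition edges_between :: "'a graph \<Rightarrow> 'a set \<Rightarrow> 'a set \<Rightarrow> 'a set set" where
  "edges_between G A B = {f \<in> edges G. \<exists>x\<in>A. \<exists>y\<in>B. f = {x, y}}"

text \<open>
  The congestion of \<open>G\<close> in \<open>T\<close>. As usual for \<open>Max\<close>, this is only meaningful if \<open>G\<close> is finite
  and \<open>T\<close> has an edge, i.e. if \<open>G\<close> has at least two vertices.
\<close>

definition edge_congestion :: "'a graph \<Rightarrow> 'a graph \<Rightarrow> nat" where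
  "edge_congestion G T =
     Max {card (edges_between G A B) | A B e.
            e \<in> edges T \<and> A \<noteq> B \<and> components (delete_edge T e) = {A, B}}"

definition spanning_tree_congestion :: "'a graph \<Rightarrow> nat" where
  "spanning_tree_congestion G = Min {edge_congestion G T | T. spanning_tree T G}"

text \<open>
  The triangular grid with \<open>k\<close> vertices on each side, meant for \<open>k \<ge> 2\<close>. Vertices are given by
  barycentric coordinates; neighbours differ by a permutation of \<open>(1, -1, 0)\<close>.
\<close>

definition grid_verts :: "nat \<Rightarrow> (nat \<times> nat \<times> nat) set" where
  "grid_verts k = {(a, b, c). a + b + c = k - 1}"

definition grid_adj :: "nat \<times> nat \<times> nat \<Rightarrow> nat \<times> nat \<times> nat \<Rightarrow> bool" where
  "grid_adj = (\<lambda>(a, b, c) (a', b', c').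
     (int a - int a', int b - int b', int c - int c')
       \<in> {(1, -1, 0), (1, 0, -1), (-1, 1, 0), (-1, 0, 1), (0, 1, -1), (0, -1, 1)})"

definition triangular_grid :: "nat \<Rightarrow> (nat \<times> nat \<times> nat) graph" where
  "triangular_grid k =
     (grid_verts k, {{u, v} | u v. u \<in> grid_verts k \<and> v \<in> grid_verts k \<and> grid_adj u v})"

lemma finite_triangular_grid: "finite (verts (triangular_grid k))"
proof -
  have "grid_verts k \<subseteq> {..k} \<times> {..k} \<times> {..k}"
    by (auto simp: grid_verts_def)
  then show ?thesis
    by (simp add: triangular_grid_def finite_subset)
qed

lemma grid_adj_irrefl: "\<not> grid_adj u u"
  by (cases u) (simp add: grid_adj_def)

lemma grid_adj_sym: "grid_adj u v \<Longrightarrow> grid_adj v u"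
proof -
  let ?D = "{(1, -1, 0), (1, 0, -1), (-1, 1, 0), (-1, 0, 1), (0, 1, -1), (0, -1, 1)}
    :: (int \<times> int \<times> int) set"
  have neg: "(x, y, z) \<in> ?D \<Longrightarrow> (- x, - y, - z) \<in> ?D" for x y z
    by (elim insertE) simp_all
  obtain a b c where u: "u = (a, b, c)" by (cases u)
  obtain a' b' c' where v: "v = (a', b', c')" by (cases v)
  assume "grid_adj u v"
  then have "(int a - int a', int b - int b', int c - int c') \<in> ?D"
    unfolding grid_adj_def u v prod.case .
  from neg[OF this] show "grid_adj v u"
    unfolding grid_adj_def u v prod.case minus_diff_eq .
qed

lemma simple_triangular_grid: "simple_graph (triangular_grid k)"
proof -
  have "card {u, v} = 2" if "grid_adj u v" for u v
    using that grid_adj_irrefl[of u] by (cases "u = v") auto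
  then show ?thesis
    by (auto simp: simple_graph_def triangular_grid_def)
qed

lemma adj_rel_triangular_grid:
  "(u, v) \<in> adj_rel (triangular_grid k) \<longleftrightarrow>
     u \<in> grid_verts k \<and> v \<in> grid_verts k \<and> grid_adj u v"
  (is "?L \<longleftrightarrow> ?R")
proof
  assume ?L
  then obtain x y where "{u, v} = {x, y}" "x \<in> grid_verts k" "y \<in> grid_verts k" "grid_adj x y"
    unfolding adj_rel_def triangular_grid_def mem_Collect_eq prod.case snd_conv by blast
  then show ?R
    using grid_adj_sym by (metis doubleton_eq_iff)
next
  assume ?R
  then show ?L
    unfolding adj_rel_def triangular_grid_def mem_Collect_eq prod.case snd_conv by blast
qed

lemma connected_triangular_grid: "connected_graph (triangular_grid k)"
proof -
  let ?R = "adj_rel (triangular_grid k)"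
  have sym: "sym (?R\<^sup>*)"
    by (intro sym_rtrancl symI) (simp add: adj_rel_triangular_grid grid_adj_sym)
  have corner: "((a, b, c), (k - 1, 0, 0)) \<in> ?R\<^sup>*" if "a + b + c = k - 1" for a b c
    using that
  proof (induction "b + c" arbitrary: a b c)
    case 0
    then show ?case by simp
  next
    case (Suc m)
    show ?case
    proof (cases b)
      case 0
      then obtain c' where c: "c = Suc c'"
        using Suc.hyps(2) by (cases c) auto
      have "((a, b, c), (Suc a, b, c')) \<in> ?R"
        using Suc.prems c by (auto simp: adj_rel_triangular_grid grid_verts_def grid_adj_def)
      moreover have "((Suc a, b, c'), (k - 1, 0, 0)) \<in> ?R\<^sup>*"
        using Suc.hyps Suc.prems c by simp
      ultimately show ?thesis
        by (rule converse_rtrancl_into_rtrancl)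
    next
      case (Suc b')
      have "((a, b, c), (Suc a, b', c)) \<in> ?R"
        using Suc.prems Suc by (auto simp: adj_rel_triangular_grid grid_verts_def grid_adj_def)
      moreover have "((Suc a, b', c), (k - 1, 0, 0)) \<in> ?R\<^sup>*"
        using Suc.hyps Suc.prems Suc by simp
      ultimately show ?thesis
        by (rule converse_rtrancl_into_rtrancl)
    qed
  qed
  have "(u, v) \<in> ?R\<^sup>*" if "u \<in> grid_verts k" "v \<in> grid_verts k" for u v
  proof -
    have "(u, (k - 1, 0, 0)) \<in> ?R\<^sup>*" "(v, (k - 1, 0, 0)) \<in> ?R\<^sup>*"
      using that by (cases u; cases v; simp add: grid_verts_def corner del: One_nat_def)+
    then show ?thesis
      by (rule rtrancl_trans[OF _ symD[OF sym]])
  qed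
  moreover have "(k - 1, 0, 0) \<in> grid_verts k"
    by (simp add: grid_verts_def)
  ultimately show ?thesis
    unfolding connected_graph_def triangular_grid_def fst_conv by blast
qed

end

theory Submission
  imports Defs
begin

text \<open>
  Lower bound: let \<open>m = (a, b, c)\<close> be the median in \<open>T\<close> of the three corners, with \<open>a\<close>, say, its
  smallest coordinate, so that \<open>a \<le> (k - 1) / 3\<close>. The edge of \<open>T\<close> at \<open>m\<close> towards the corner
  \<open>(k - 1, 0, 0)\<close> splits off a connected set \<open>A\<close> that reaches from this corner down to the level
  \<open>a + 1\<close>, while its complement connects the other two corners. For every \<open>t < k - 1 - a\<close> the
  three rows with first coordinate \<open>k - 1 - t\<close>, second coordinate \<open>t\<close> and third coordinate \<open>t\<close>
  together contain two cut edges, which gives \<open>2 (k - 1 - a)\<close> of them.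

  Upper bound: let \<open>3 q - 2 \<le> k \<le> 3 q\<close>. The sector \<open>a \<ge> q, b < q\<close> and its two rotations form a
  pinwheel that covers the grid, up to the vertex \<open>(q - 1, q - 1, q - 1)\<close> if \<open>k = 3 q - 2\<close>. In the
  sector the tree has a spine that follows \<open>b = q - 1\<close> up to the side \<open>c = 0\<close> and then this side
  up to the corner; the rest of every row with constant \<open>a\<close> is a path that hangs off the spine. An
  edge of the spine cuts at most \<open>2 (k - q)\<close> edges, and one of the paths at most \<open>4 (q - 1)\<close>.
\<close>

section \<open>Edge cuts of trees\<close>

lemma sym_adj_rel: "sym (adj_rel G)"
  by (auto simp: adj_rel_def sym_def insert_commute)

lemma sym_adj_rel_rtrancl: "(u, v) \<in> (adj_rel G)\<^sup>* \<Longrightarrow> (v, u) \<in> (adj_rel G)\<^sup>*"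
  using symD[OF sym_rtrancl[OF sym_adj_rel]] .

text \<open>Prepend \<open>x\<close> to a distinct path from its successor; if \<open>x\<close>
  already occurs there, keep only the part that starts at \<open>x\<close>.\<close>

lemma rtrancl_imp_distinct_path:
  assumes "(x, y) \<in> R\<^sup>*"
  shows "\<exists>p. p \<noteq> [] \<and> hd p = x \<and> last p = y \<and> distinct p \<and> successively (\<lambda>a b. (a, b) \<in> R) p"
  using assms
proof (induction rule: converse_rtrancl_induct)
  case base
  then show ?case by (intro exI[of _ "[y]"]) simp
next
  case (step x z)
  then obtain p where p: "p \<noteq> []" "hd p = z" "last p = y" "distinct p"
    "successively (\<lambda>a b. (a, b) \<in> R) p" by blast
  show ?case
  proof (cases "x \<in> set p")
    case False
    with p step.hyps show ?thesis
      by (intro exI[of _ "x # p"]) (auto simp: successively_Cons)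
  next
    case True
    then obtain p1 p2 where "p = p1 @ x # p2"
      by (meson split_list)
    with p show ?thesis
      by (intro exI[of _ "x # p2"]) (auto simp: successively_append_iff)
  qed
qed

text \<open>The pair stands for the edge oriented from \<open>u\<close> to \<open>v\<close>, and the
  set is the component ahead of the arrow. For an edge of a tree, swapping the arguments gives the
  other component.\<close>

definition side :: "'a graph \<Rightarrow> 'a \<Rightarrow> 'a \<Rightarrow> 'a set" where
  "side T u v = (adj_rel (delete_edge T {u, v}))\<^sup>* `` {v}"

lemma adj_rel_delete_edge:
  "(x, y) \<in> adj_rel (delete_edge T e) \<longleftrightarrow> {x, y} \<in> edges T \<and> {x, y} \<noteq> e"
  by (simp add: adj_rel_def delete_edge_def)

lemma side_self: "v \<in> side T u v"
  by (simp add: side_def)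

lemma side_step:
  "x \<in> side T u v \<Longrightarrow> {x, y} \<in> edges T \<Longrightarrow> {x, y} \<noteq> {u, v} \<Longrightarrow> y \<in> side T u v"
  unfolding side_def Image_singleton_iff
  by (erule rtrancl_into_rtrancl) (simp add: adj_rel_delete_edge)

lemma side_induct [consumes 1, case_names base step]:
  assumes "x \<in> side T u v" "P v"
    and "\<And>x y. x \<in> side T u v \<Longrightarrow> P x \<Longrightarrow> {x, y} \<in> edges T \<Longrightarrow> {x, y} \<noteq> {u, v} \<Longrightarrow> P y"
  shows "P x"
proof -
  have "(v, x) \<in> (adj_rel (delete_edge T {u, v}))\<^sup>*"
    using assms(1) by (simp add: side_def)
  then show ?thesis
  proof (induction rule: rtrancl_induct)
    case base
    show ?case by fact
  next
    case (step y z)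
    then show ?case
      using assms(3)[of y z] by (simp add: side_def adj_rel_delete_edge)
  qed
qed

lemma simple_graph_edgeD:
  assumes "simple_graph G" "{u, v} \<in> edges G"
  shows "u \<in> verts G" "v \<in> verts G" "u \<noteq> v"
  using assms by (auto simp: simple_graph_def)

lemma side_subset_verts:
  assumes "simple_graph T" "v \<in> verts T"
  shows "side T u v \<subseteq> verts T"
proof
  fix x assume "x \<in> side T u v"
  then show "x \<in> verts T"
    using assms by (induction rule: side_induct) (auto dest: simple_graph_edgeD)
qed

text \<open>A distinct path from \<open>v\<close> to \<open>u\<close> that avoids the edge would
  close with it to a cycle.\<close>

lemma not_in_side:
  assumes T: "tree T" and e: "{u, v} \<in> edges T"
  shows "u \<notin> side T u v"
proof
  let ?R = "adj_rel (delete_edge T {u, v})"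
  assume "u \<in> side T u v"
  then have "(v, u) \<in> ?R\<^sup>*"
    by (simp add: side_def)
  then obtain p where p: "p \<noteq> []" "hd p = v" "last p = u" "distinct p"
    "successively (\<lambda>a b. (a, b) \<in> ?R) p"
    using rtrancl_imp_distinct_path[of v u ?R] by blast
  have "u \<noteq> v"
    using simple_graph_edgeD(3)[of T u v] T e by (simp add: tree_def)
  have step: "{p ! i, p ! Suc i} \<in> edges T" "{p ! i, p ! Suc i} \<noteq> {u, v}"
    if "Suc i < length p" for i
    using p(5) that by (auto simp: successively_conv_nth adj_rel_delete_edge)
  have hd: "p ! 0 = v" and lst: "p ! (length p - 1) = u"
    using p by (simp_all add: hd_conv_nth last_conv_nth)
  have "length p \<noteq> 0" "length p \<noteq> 1"
    using hd lst \<open>p \<noteq> []\<close> \<open>u \<noteq> v\<close> by auto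
  \<comment> \<open>A path on two vertices would be the deleted edge itself, so the cycle has the
    three vertices that \<open>is_cycle\<close> demands.\<close>
  moreover have "length p \<noteq> 2"
    using step(2)[of 0] hd lst by (auto simp: insert_commute)
  ultimately have len: "length p \<ge> 3"
    by linarith
  have "{p ! i, p ! (Suc i mod length p)} \<in> edges T" if "i < length p" for i
  proof (cases "Suc i < length p")
    case True
    then show ?thesis using step(1) by simp
  next
    case False
    then have "i = length p - 1" "Suc i = length p"
      using that by auto
    then show ?thesis
      using hd lst e by simp
  qed
  then have "is_cycle T p"
    using len p(4) by (auto simp: is_cycle_def)
  then show False
    using T by (auto simp: tree_def)
qed

text \<open>Along a walk from \<open>v\<close> in \<open>T\<close>, a step either stays in its side
  or is the deleted edge, and then it arrives at \<open>u\<close> or \<open>v\<close>, each of which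
  lies in one of the sides.\<close>

lemma side_cover:
  assumes T: "tree T" and e: "{u, v} \<in> edges T"
  shows "side T u v \<union> side T v u = verts T"
proof
  have simple: "simple_graph T"
    using T by (simp add: tree_def)
  have uv: "u \<in> verts T" "v \<in> verts T"
    using simple_graph_edgeD[OF simple e] by simp_all
  then show "side T u v \<union> side T v u \<subseteq> verts T"
    using side_subset_verts[OF simple] by simp
  show "verts T \<subseteq> side T u v \<union> side T v u"
  proof
    fix x assume "x \<in> verts T"
    then have "(v, x) \<in> (adj_rel T)\<^sup>*"
      using T uv by (auto simp: tree_def connected_graph_def)
    then show "x \<in> side T u v \<union> side T v u"
    proof (induction rule: rtrancl_induct)
      case base
      then show ?case by (simp add: side_self)
    next
      case (step y z)
      have yz: "{y, z} \<in> edges T"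
        using step.hyps(2) by (simp add: adj_rel_def)
      show ?case
      proof (cases "{y, z} = {u, v}")
        case True
        then have "z = u \<or> z = v"
          by blast
        then show ?thesis
          using side_self by fast
      next
        case False
        then have "{y, z} \<noteq> {v, u}"
          by blast
        then show ?thesis
          using step.IH side_step[OF _ yz] False by fast
      qed
    qed
  qed
qed

text \<open>Reachability is symmetric, so any member of a side can replace \<open>v\<close> as its
  base point.\<close>

lemma side_eq_Image:
  assumes "x \<in> side T u v"
  shows "(adj_rel (delete_edge T {u, v}))\<^sup>* `` {x} = side T u v"
proof -
  have vx: "(v, x) \<in> (adj_rel (delete_edge T {u, v}))\<^sup>*"
    using assms by (simp add: side_def)
  show ?thesis
    unfolding side_def
    using rtrancl_trans[OF vx] rtrancl_trans[OF sym_adj_rel_rtrancl[OF vx]] by fast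
qed

lemma side_disjoint:
  assumes T: "tree T" and e: "{u, v} \<in> edges T"
  shows "side T u v \<inter> side T v u = {}"
proof (rule ccontr)
  assume "side T u v \<inter> side T v u \<noteq> {}"
  then obtain x where "x \<in> side T u v" "x \<in> side T v u"
    by blast
  then have "side T u v = side T v u"
    using side_eq_Image[of x T u v] side_eq_Image[of x T v u] by (simp add: insert_commute)
  then show False
    using not_in_side[OF T e] side_self[of u T v] by simp
qed

text \<open>The bridge from the quotient in \<open>components\<close> to the two sides, in terms of
  which all later cuts are expressed.\<close>

lemma components_delete_edge:
  assumes T: "tree T" and e: "{u, v} \<in> edges T"
  shows "components (delete_edge T {u, v}) = {side T u v, side T v u}"
proof -
  let ?R = "adj_rel (delete_edge T {u, v})"
  have uv: "u \<in> verts T" "v \<in> verts T"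
    using simple_graph_edgeD(1,2)[of T u v] T e by (simp_all add: tree_def)
  have sides: "side T u v = ?R\<^sup>* `` {v}" "side T v u = ?R\<^sup>* `` {u}"
    by (simp_all add: side_def insert_commute)
  have img: "?R\<^sup>* `` {x} \<in> {side T u v, side T v u}" if "x \<in> verts T" for x
  proof -
    have "x \<in> side T u v \<or> x \<in> side T v u"
      using that side_cover[OF T e] by blast
    then show ?thesis
    proof
      assume "x \<in> side T u v"
      then show ?thesis
        using side_eq_Image by fast
    next
      assume "x \<in> side T v u"
      then have "?R\<^sup>* `` {x} = side T v u"
        using side_eq_Image[of x T v u] by (simp add: insert_commute)
      then show ?thesis
        by simp
    qed
  qed
  have "components (delete_edge T {u, v}) = (\<lambda>x. ?R\<^sup>* `` {x}) ` verts T"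
    unfolding components_def quotient_def delete_edge_def by auto
  also have "\<dots> = {side T u v, side T v u}"
  proof
    show "(\<lambda>x. ?R\<^sup>* `` {x}) ` verts T \<subseteq> {side T u v, side T v u}"
      using img by (rule image_subsetI)
    show "{side T u v, side T v u} \<subseteq> (\<lambda>x. ?R\<^sup>* `` {x}) ` verts T"
      unfolding sides using uv by blast
  qed
  finally show ?thesis .
qed

section \<open>Congestion in terms of the sides of tree edges\<close>

lemma edges_between_commute: "edges_between G A B = edges_between G B A"
proof -
  have "(\<exists>x\<in>A. \<exists>y\<in>B. f = {x, y}) \<longleftrightarrow> (\<exists>x\<in>B. \<exists>y\<in>A. f = {x, y})" for f
    by (metis insert_commute)
  then show ?thesis
    by (simp add: edges_between_def)
qed

lemma finite_congestions:
  assumes "finite (edges G)"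
  shows "finite {card (edges_between G A B) | A B e. P A B e}"
proof (rule finite_subset)
  have "card (edges_between G A B) \<le> card (edges G)" for A B
    using assms by (rule card_mono) (simp add: edges_between_def)
  then show "{card (edges_between G A B) | A B e. P A B e} \<subseteq> {..card (edges G)}"
    unfolding subset_iff mem_Collect_eq atMost_iff by metis
qed simp

lemma edge_congestion_ge:
  assumes "finite (edges G)" "tree T" "{u, v} \<in> edges T"
  shows "card (edges_between G (side T u v) (side T v u)) \<le> edge_congestion G T"
proof -
  have ne: "side T u v \<noteq> side T v u"
    using side_disjoint[OF assms(2,3)] side_self[of v T u] by auto
  have "\<exists>A B e. card (edges_between G (side T u v) (side T v u)) = card (edges_between G A B) \<and>
      e \<in> edges T \<and> A \<noteq> B \<and> components (delete_edge T e) = {A, B}"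
    by (rule exI[of _ "side T u v"], rule exI[of _ "side T v u"], rule exI[of _ "{u, v}"])
      (simp add: ne assms(3) components_delete_edge[OF assms(2,3)])
  then show ?thesis
    unfolding edge_congestion_def
    by (intro Max_ge finite_congestions[OF assms(1)] CollectI)
qed

text \<open>A bound on all members bounds \<open>Max\<close> only if there is a member, whence the
  assumption that \<open>T\<close> has an edge. The disjunction lets each cut be bounded in either
  orientation.\<close>

lemma edge_congestion_le:
  assumes "finite (edges G)" "tree T" "edges T \<noteq> {}"
    and le: "\<And>u v. {u, v} \<in> edges T \<Longrightarrow>
      card (edges_between G (side T u v) (side T v u)) \<le> M \<or>
      card (edges_between G (side T v u) (side T u v)) \<le> M"
  shows "edge_congestion G T \<le> M"
proof -
  have simple: "simple_graph T"
    using assms(2) by (simp add: tree_def)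
  have form: "\<exists>u v. e = {u, v}" if "e \<in> edges T" for e
  proof -
    have "card e = 2"
      using simple that by (simp add: simple_graph_def)
    then show ?thesis
      unfolding card_2_iff by blast
  qed
  let ?C = "{card (edges_between G A B) | A B e.
    e \<in> edges T \<and> A \<noteq> B \<and> components (delete_edge T e) = {A, B}}"
  obtain u v where uv: "{u, v} \<in> edges T"
    using assms(3) form by (metis all_not_in_conv)
  have ne: "side T u v \<noteq> side T v u"
    using side_disjoint[OF assms(2) uv] side_self[of v T u] by auto
  have "card (edges_between G (side T u v) (side T v u)) \<in> ?C"
    by (rule CollectI, rule exI[of _ "side T u v"], rule exI[of _ "side T v u"],
        rule exI[of _ "{u, v}"]) (simp add: ne uv components_delete_edge[OF assms(2) uv])
  then have ne: "?C \<noteq> {}"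
    by (rule ex_in_conv[THEN iffD1, OF exI])
  have le: "c \<le> M" if "c \<in> ?C" for c
  proof -
    obtain A B e where c: "c = card (edges_between G A B)" "e \<in> edges T"
      "components (delete_edge T e) = {A, B}"
      using \<open>c \<in> ?C\<close> by (elim CollectE exE conjE) (rule that; assumption)
    obtain u v where e: "e = {u, v}"
      using form c(2) by blast
    have "{A, B} = {side T u v, side T v u}"
      using components_delete_edge[OF assms(2), of u v] c(2,3) unfolding e by simp
    then have "A = side T u v \<and> B = side T v u \<or> A = side T v u \<and> B = side T u v"
      by (simp only: doubleton_eq_iff)
    then show ?thesis
      using le[of u v] edges_between_commute[of G A B] c(1,2) unfolding e by metis
  qed
  show ?thesis
    unfolding edge_congestion_def
    by (rule Max.boundedI[OF finite_congestions[OF assms(1)] ne le])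
qed

lemma spanning_tree_congestion_eqI:
  assumes "finite (verts G)" "finite (edges G)"
    and "spanning_tree T G" "edge_congestion G T \<le> M"
    and ge: "\<And>T. spanning_tree T G \<Longrightarrow> M \<le> edge_congestion G T"
  shows "spanning_tree_congestion G = M"
proof -
  let ?C = "{edge_congestion G T | T. spanning_tree T G}"
  \<comment> \<open>With the vertex set fixed, a spanning tree is given by a subset of
    \<open>edges G\<close>, so \<open>Min\<close> ranges over a finite set.\<close>
  have "{T. spanning_tree T G} \<subseteq> {verts G} \<times> Pow (edges G)"
    by (auto simp: spanning_tree_def subgraph_def)
  then have "finite {T. spanning_tree T G}"
    using assms(2) by (meson finite.emptyI finite.insertI finite_Pow_iff finite_SigmaI finite_subset)
  then have "finite ?C"
    unfolding setcompr_eq_image by (rule finite_imageI)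
  moreover have "edge_congestion G T = M"
    using assms by (simp add: le_antisym)
  ultimately show ?thesis
    unfolding spanning_tree_congestion_def
    using assms(3) ge by (intro Min_eqI) blast+
qed

section \<open>The median of three vertices in a tree\<close>

lemma side_psubset:
  assumes T: "tree T" and uv: "{u, v} \<in> edges T" and vw: "{v, w} \<in> edges T" and "w \<noteq> u"
  shows "side T v w \<subset> side T u v"
proof -
  \<comment> \<open>The side beyond \<open>w\<close> avoids \<open>v\<close>, so a walk in it never
    uses the edge between \<open>u\<close> and \<open>v\<close>. This gives the inclusion, and
    \<open>v\<close> itself makes it strict.\<close>
  have v: "v \<notin> side T v w"
    using not_in_side[OF T vw] .
  have "x \<in> side T u v" if x: "x \<in> side T v w" for x
  proof (rule side_induct[OF x])
    have "{v, w} \<noteq> {u, v}"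
      using \<open>w \<noteq> u\<close> by (simp add: doubleton_eq_iff)
    then show "w \<in> side T u v"
      by (rule side_step[OF side_self vw])
  next
    fix x y
    assume xy: "x \<in> side T v w" "x \<in> side T u v" "{x, y} \<in> edges T" "{x, y} \<noteq> {v, w}"
    have "y \<in> side T v w"
      using xy(1,3,4) by (rule side_step)
    then have "x \<noteq> v" "y \<noteq> v"
      using xy(1) v by metis+
    then have "{x, y} \<noteq> {u, v}"
      by (simp add: doubleton_eq_iff)
    with xy(2,3) show "y \<in> side T u v"
      by (rule side_step)
  qed
  then show ?thesis
    using v side_self[of v T u] by auto
qed

text \<open>
  Orient every edge of a tree towards the side that holds at least two of three marked
  vertices. Following the orientation ends at a vertex whose edges all point to it, the median.
\<close>

lemma tree_median:
  assumes T: "tree T" and fin: "finite (verts T)"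
    and C: "C \<subseteq> verts T" "card C = 3"
  shows "\<exists>m\<in>verts T. \<forall>u. {m, u} \<in> edges T \<longrightarrow> card (C \<inter> side T m u) \<le> 1"
proof (rule ccontr)
  assume "\<not> ?thesis"
  then have out: "\<exists>u. {m, u} \<in> edges T \<and> 2 \<le> card (C \<inter> side T m u)" if "m \<in> verts T" for m
    using that by (force simp: not_le)
  have simple: "simple_graph T"
    using T by (simp add: tree_def)
  have finC: "finite C"
    using C fin finite_subset by blast
  \<comment> \<open>\<open>Q\<close> holds for the oriented edges with at least two marked vertices
    ahead. Instead of following the orientation, the proof takes such an edge with the smallest side
    ahead; going on from it would make that side smaller still.\<close>
  define Q where "Q = (\<lambda>(u, v). {u, v} \<in> edges T \<and> 2 \<le> card (C \<inter> side T u v))"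
  obtain m0 where "m0 \<in> verts T"
    using C by fastforce
  then obtain p0 where "Q p0"
    unfolding Q_def using out by fast
  then obtain p where p: "Q p" and min: "\<And>p'. Q p' \<Longrightarrow>
      card (side T (fst p) (snd p)) \<le> card (side T (fst p') (snd p'))"
    using ex_has_least_nat[of Q p0 "\<lambda>p. card (side T (fst p) (snd p))"] by blast
  obtain u v where uv: "p = (u, v)" by (cases p)
  have e: "{u, v} \<in> edges T" and big: "2 \<le> card (C \<inter> side T u v)"
    using p by (auto simp: Q_def uv)
  have vV: "v \<in> verts T"
    using simple_graph_edgeD[OF simple e] by simp
  then obtain w where vw: "{v, w} \<in> edges T" "2 \<le> card (C \<inter> side T v w)"
    using out by blast
  show False
  proof (cases "w = u")
    case True
    \<comment> \<open>Turning back along the same edge would need two marked vertices on each of two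
      disjoint sides, four in all.\<close>
    have "card (C \<inter> side T u v) + card (C \<inter> side T v u)
        = card ((C \<inter> side T u v) \<union> (C \<inter> side T v u))"
      using side_disjoint[OF T e] finC by (intro card_Un_disjoint[symmetric]) auto
    also have "\<dots> \<le> card C"
      using finC by (intro card_mono) auto
    finally show False
      using C big vw True by simp
  next
    case False
    have "side T v w \<subset> side T u v"
      using side_psubset[OF T e vw(1) False] .
    moreover have "finite (side T u v)"
      using side_subset_verts[OF simple vV] fin finite_subset by blast
    ultimately have "card (side T v w) < card (side T u v)"
      by (simp add: psubset_card_mono)
    moreover have "Q (v, w)"
      using vw by (simp add: Q_def)
    ultimately show False
      using min[of "(v, w)"] by (simp add: uv)
  qed
qed

text \<open>A walk from \<open>m\<close> enters a branch at a neighbour of \<open>m\<close> and can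
  leave it only through \<open>m\<close> again.\<close>

lemma in_some_side:
  assumes T: "tree T" and "m \<in> verts T" "x \<in> verts T" "x \<noteq> m"
  obtains u where "{m, u} \<in> edges T" "x \<in> side T m u"
proof -
  have "(m, x) \<in> (adj_rel T)\<^sup>*"
    using assms by (auto simp: tree_def connected_graph_def)
  then have "x = m \<or> (\<exists>u. {m, u} \<in> edges T \<and> x \<in> side T m u)"
  proof (induction rule: rtrancl_induct)
    case base
    show ?case by simp
  next
    case (step y z)
    have yz: "{y, z} \<in> edges T"
      using step.hyps(2) by (simp add: adj_rel_def)
    show ?case
    proof (cases "y = m \<or> z = m")
      case True
      then show ?thesis
        using yz side_self[of z T m] by auto
    next
      case False
      then obtain u where u: "{m, u} \<in> edges T" "y \<in> side T m u"
        using step.IH by blast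
      have "{y, z} \<noteq> {m, u}"
        using False by blast
      then have "z \<in> side T m u"
        by (rule side_step[OF u(2) yz])
      then show ?thesis
        using u by blast
    qed
  qed
  then show ?thesis
    using that assms by blast
qed

section \<open>Lower bound for the triangular grid\<close>

text \<open>The rotation of the triangle, a symmetry of order three. It allows one corner or one
  sector to be treated in place of all three.\<close>

definition rot :: "nat \<times> nat \<times> nat \<Rightarrow> nat \<times> nat \<times> nat" where
  "rot = (\<lambda>(a, b, c). (b, c, a))"

lemma rot_simp [simp]: "rot (a, b, c) = (b, c, a)"
  by (simp add: rot_def)

lemma rot_rot_rot [simp]: "rot (rot (rot v)) = v"
  by (cases v) simp

lemma rot_grid_verts [simp]: "rot v \<in> grid_verts k \<longleftrightarrow> v \<in> grid_verts k"
  by (cases v) (auto simp: grid_verts_def)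

text \<open>Equations over the naturals replace the integer differences, so that case distinctions
  yield facts for linear arithmetic.\<close>

lemma grid_adj_iff:
  "grid_adj (a, b, c) (a', b', c') \<longleftrightarrow>
     a = a' + 1 \<and> b' = b + 1 \<and> c = c' \<or> a = a' + 1 \<and> b = b' \<and> c' = c + 1 \<or>
     a' = a + 1 \<and> b = b' + 1 \<and> c = c' \<or> a' = a + 1 \<and> b = b' \<and> c = c' + 1 \<or>
     a = a' \<and> b = b' + 1 \<and> c' = c + 1 \<or> a = a' \<and> b' = b + 1 \<and> c = c' + 1"
proof -
  have "int x - int y = 1 \<longleftrightarrow> x = y + 1" "int x - int y = - 1 \<longleftrightarrow> y = x + 1"
    "int x - int y = 0 \<longleftrightarrow> x = y" for x y
    by linarith+
  then show ?thesis
    unfolding grid_adj_def prod.case insert_iff empty_iff prod.inject by presburger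
qed

lemma grid_adj_rot [simp]: "grid_adj (rot u) (rot v) \<longleftrightarrow> grid_adj u v"
  unfolding rot_def by (cases u; cases v) (simp only: prod.case grid_adj_iff, rule iffI; elim disjE; simp)

lemma funpow_rot_grid_verts [simp]: "(rot ^^ i) v \<in> grid_verts k \<longleftrightarrow> v \<in> grid_verts k"
  by (induction i) simp_all

lemma grid_adj_funpow_rot [simp]: "grid_adj ((rot ^^ i) u) ((rot ^^ i) v) \<longleftrightarrow> grid_adj u v"
  by (induction i) simp_all

lemma verts_triangular_grid [simp]: "verts (triangular_grid k) = grid_verts k"
  by (simp add: triangular_grid_def)

lemma edge_triangular_grid_iff:
  "{u, v} \<in> edges (triangular_grid k) \<longleftrightarrow> u \<in> grid_verts k \<and> v \<in> grid_verts k \<and> grid_adj u v"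
  using adj_rel_triangular_grid by (auto simp: adj_rel_def)

lemma finite_edges_triangular_grid: "finite (edges (triangular_grid k))"
proof (rule finite_subset)
  show "edges (triangular_grid k) \<subseteq> Pow (grid_verts k)"
    by (auto simp: triangular_grid_def)
  show "finite (Pow (grid_verts k))"
    using finite_triangular_grid[of k] by simp
qed

lemma finite_edges_between: "finite (edges_between (triangular_grid k) A B)"
  using finite_edges_triangular_grid by (simp add: edges_between_def)

lemma edges_between_triangular_grid:
  "edges_between (triangular_grid k) A B =
     {{x, y} | x y. x \<in> A \<and> y \<in> B \<and> x \<in> grid_verts k \<and> y \<in> grid_verts k \<and> grid_adj x y}"
proof -
  have "f \<in> edges (triangular_grid k) \<and> f = {x, y} \<longleftrightarrow>
      f = {x, y} \<and> x \<in> grid_verts k \<and> y \<in> grid_verts k \<and> grid_adj x y" for f x y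
    using edge_triangular_grid_iff[of x y k] by blast
  then show ?thesis
    unfolding edges_between_def by blast
qed

text \<open>Rotation maps the original cut onto a superset of the rotated one. Both the lower and
  the upper bound use this direction.\<close>

lemma card_edges_between_rot:
  "card (edges_between (triangular_grid k) (rot ` A) (rot ` B))
     \<le> card (edges_between (triangular_grid k) A B)"
proof -
  have "edges_between (triangular_grid k) (rot ` A) (rot ` B)
      \<subseteq> image rot ` edges_between (triangular_grid k) A B"
  proof
    fix f assume "f \<in> edges_between (triangular_grid k) (rot ` A) (rot ` B)"
    then obtain x y where f: "f = {x, y}" "x \<in> rot ` A" "y \<in> rot ` B"
      "x \<in> grid_verts k" "y \<in> grid_verts k" "grid_adj x y"
      unfolding edges_between_triangular_grid by blast
    then obtain a b where ab: "x = rot a" "y = rot b" "a \<in> A" "b \<in> B"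
      by blast
    have "a \<in> grid_verts k" "b \<in> grid_verts k" "grid_adj a b"
      using f ab by simp_all
    then have "{a, b} \<in> edges_between (triangular_grid k) A B"
      using ab unfolding edges_between_triangular_grid by blast
    moreover have "f = rot ` {a, b}"
      using f ab by simp
    ultimately show "f \<in> image rot ` edges_between (triangular_grid k) A B"
      by blast
  qed
  then show ?thesis
    by (rule surj_card_le[OF finite_edges_between])
qed

lemma card_edges_between_funpow_rot:
  "card (edges_between (triangular_grid k) ((rot ^^ i) ` A) ((rot ^^ i) ` B))
     \<le> card (edges_between (triangular_grid k) A B)"
proof (induction i)
  case (Suc i)
  have "(rot ^^ Suc i) ` X = rot ` (rot ^^ i) ` X" for X
    by (simp add: image_comp)
  then show ?case
    using card_edges_between_rot[of k "(rot ^^ i) ` A" "(rot ^^ i) ` B"] Suc by simp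
qed simp

section \<open>Cut edges found along rows of the grid\<close>

lemma discrete_change:
  fixes P :: "nat \<Rightarrow> bool"
  assumes "i \<le> j" "P i \<noteq> P j"
  shows "\<exists>l\<ge>i. l < j \<and> P l \<noteq> P (Suc l)"
  using assms
proof (induction j rule: dec_induct)
  case (step j)
  then show ?case
    by (metis less_Suc_eq)
qed simp

text \<open>The row is a path \<open>f 0\<close>, ..., \<open>f n\<close>. Since \<open>A\<close>
  and \<open>B\<close> partition the grid, the last hypothesis says that \<open>f i\<close> and
  \<open>f j\<close> lie on different sides, in either order. The range of \<open>l\<close> serves
  to tell crossings on separate stretches of one row apart.\<close>

lemma row_crossing:
  assumes AB: "A \<union> B = grid_verts k" "A \<inter> B = {}"
    and row: "\<And>l. l \<le> n \<Longrightarrow> f l \<in> grid_verts k" "\<And>l. l < n \<Longrightarrow> grid_adj (f l) (f (Suc l))"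
    and ij: "i \<le> j" "j \<le> n" "f i \<in> A \<longleftrightarrow> f j \<in> B"
  shows "\<exists>l. i \<le> l \<and> l < j \<and> {f l, f (Suc l)} \<in> edges_between (triangular_grid k) A B"
proof -
  have "(f i \<in> A) \<noteq> (f j \<in> A)"
    using AB row(1)[of j] ij by auto
  then obtain l where l: "i \<le> l" "l < j" "(f l \<in> A) \<noteq> (f (Suc l) \<in> A)"
    using discrete_change[of i j "\<lambda>l. f l \<in> A"] ij by auto
  have "f l \<in> grid_verts k" "f (Suc l) \<in> grid_verts k" "grid_adj (f l) (f (Suc l))"
    using row l ij by auto
  moreover from this have "f l \<in> A \<and> f (Suc l) \<in> B \<or> f (Suc l) \<in> A \<and> f l \<in> B"
    using l AB by auto
  ultimately have "{f l, f (Suc l)} \<in> edges_between (triangular_grid k) A B"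
    unfolding edges_between_def using edge_triangular_grid_iff by (auto simp: insert_commute)
  with l show ?thesis
    by blast
qed

text \<open>
  For every \<open>t \<le> s\<close> the three rows below carry two cut edges between them: if the end
  \<open>(k - 1 - t, t, 0)\<close> of the first row is in \<open>A\<close>, then the second row changes sides, and
  otherwise the first row does so between this end and its vertex in \<open>A\<close>; the same holds for
  the other end of the first row, with the third row.
\<close>

lemma card_cut_ge:
  assumes AB: "A \<union> B = grid_verts k" "A \<inter> B = {}" and s: "s \<le> k - 1"
    and rowA: "\<And>t. t \<le> s \<Longrightarrow> \<exists>x\<in>A. fst x = k - 1 - t"
    and rowB: "\<And>t. t \<le> s \<Longrightarrow> \<exists>x\<in>B. fst (snd x) = t" "\<And>t. t \<le> s \<Longrightarrow> \<exists>x\<in>B. snd (snd x) = t"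
  shows "2 * (s + 1) \<le> card (edges_between (triangular_grid k) A B)"
proof -
  define K where "K = k - 1"
  define E where "E = edges_between (triangular_grid k) A B"
  define F where "F t = {f \<in> E. (\<forall>x\<in>f. fst x = K - t) \<or> (\<forall>x\<in>f. fst (snd x) = t) \<or>
    (\<forall>x\<in>f. snd (snd x) = t)}" for t
  have finE: "finite E"
    unfolding E_def by (rule finite_edges_between)
  have gv: "(a, b, c) \<in> grid_verts k \<longleftrightarrow> a + b + c = K" for a b c
    by (simp add: grid_verts_def K_def)
  have E_cases: "\<exists>a b c a' b' c'. f = {(a, b, c), (a', b', c')} \<and> a + b + c = K \<and>
      a' + b' + c' = K \<and> (a, b, c) \<noteq> (a', b', c')" if f: "f \<in> E" for f
  proof -
    obtain x y where xy: "f = {x, y}" "x \<in> grid_verts k" "y \<in> grid_verts k" "x \<noteq> y"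
      using f grid_adj_irrefl unfolding E_def edges_between_triangular_grid by blast
    obtain a b c where x: "x = (a, b, c)" by (cases x)
    obtain a' b' c' where y: "y = (a', b', c')" by (cases y)
    show ?thesis
      using xy gv unfolding x y by blast
  qed
  have two: "2 \<le> card (F t)" if t: "t \<le> s" for t
  proof -
    have tK: "t \<le> K"
      using t s by (simp add: K_def)
    \<comment> \<open>The rows are parametrised so that they share ends: \<open>?a 0 = ?b 0\<close>
      and \<open>?a t = ?c 0\<close>. Their vertices \<open>?a z\<close> in \<open>A\<close>,
      \<open>?b zb\<close> in \<open>B\<close> and \<open>?c zc\<close> in \<open>B\<close> force
      the crossings.\<close>
    let ?a = "\<lambda>l. (K - t, t - l, l)" and ?b = "\<lambda>l. (K - t - l, t, l)"
      and ?c = "\<lambda>l. (K - t - l, l, t)"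
    obtain z where z: "?a z \<in> A" "z \<le> t"
    proof -
      obtain a b c where abc: "(a, b, c) \<in> A" "a = K - t"
        using rowA[OF t] by (auto simp: K_def)
      then have "a + b + c = K"
        using AB gv by blast
      then have eq: "?a c = (a, b, c)" and "c \<le> t"
        using abc tK by auto
      moreover have "?a c \<in> A"
        unfolding eq by (rule abc(1))
      ultimately show thesis
        using that by blast
    qed
    obtain zb where zb: "?b zb \<in> B" "zb \<le> K - t"
    proof -
      obtain a b c where abc: "(a, b, c) \<in> B" "b = t"
        using rowB(1)[OF t] by auto
      then have "a + b + c = K"
        using AB gv by blast
      then have eq: "?b c = (a, b, c)" and "c \<le> K - t"
        using abc tK by auto
      moreover have "?b c \<in> B"
        unfolding eq by (rule abc(1))
      ultimately show thesis
        using that by blast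
    qed
    obtain zc where zc: "?c zc \<in> B" "zc \<le> K - t"
    proof -
      obtain a b c where abc: "(a, b, c) \<in> B" "c = t"
        using rowB(2)[OF t] by auto
      then have "a + b + c = K"
        using AB gv by blast
      then have eq: "?c b = (a, b, c)" and "b \<le> K - t"
        using abc tK by auto
      moreover have "?c b \<in> B"
        unfolding eq by (rule abc(1))
      ultimately show thesis
        using that by blast
    qed
    have row_a: "?a l \<in> grid_verts k" if "l \<le> t" for l
      using that tK by (simp add: gv)
    have adj_a: "grid_adj (?a l) (?a (Suc l))" if "l < t" for l
      using that by (auto simp: grid_adj_iff)
    have row_b: "?b l \<in> grid_verts k" "?c l \<in> grid_verts k" if "l \<le> K - t" for l
      using that tK by (simp_all add: gv)
    have adj_b: "grid_adj (?b l) (?b (Suc l))" "grid_adj (?c l) (?c (Suc l))"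
      if "l < K - t" for l
      using that by (auto simp: grid_adj_iff)
    have cross: "\<exists>l. i \<le> l \<and> l < j \<and> {?a l, ?a (Suc l)} \<in> E"
      if "i \<le> j" "j \<le> t" "?a i \<in> A \<longleftrightarrow> ?a j \<in> B" for i j
      unfolding E_def using row_crossing[where f = ?a and n = t, OF AB row_a adj_a that] .
    have cross': "\<exists>l. {?b l, ?b (Suc l)} \<in> E" if "?b 0 \<in> A"
      unfolding E_def
      using row_crossing[where f = ?b and n = "K - t" and i = 0 and j = zb, OF AB row_b(1) adj_b(1)]
        zb that by blast
    have cross'': "\<exists>l. {?c l, ?c (Suc l)} \<in> E" if "?c 0 \<in> A"
      unfolding E_def
      using row_crossing[where f = ?c and n = "K - t" and i = 0 and j = zc, OF AB row_b(2) adj_b(2)]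
        zc that by blast
    \<comment> \<open>The vertex \<open>?a z\<close> splits the first row. A crossing taken from
      that row is recorded as lying before \<open>z\<close> here and beyond \<open>z\<close> for the
      second edge \<open>g\<close> below, so the two cannot coincide.\<close>
    have "\<exists>f\<in>E. (\<forall>x\<in>f. fst (snd x) = t) \<or>
        (\<forall>x\<in>f. fst x = K - t) \<and> (\<forall>x\<in>f. snd (snd x) \<le> z)"
    proof (cases "?a 0 \<in> A")
      case True
      then have "?b 0 \<in> A"
        by simp
      then obtain l where "{?b l, ?b (Suc l)} \<in> E"
        using cross' by blast
      then show ?thesis
        by (intro bexI[of _ "{?b l, ?b (Suc l)}"]) simp_all
    next
      case False
      then have "?a 0 \<notin> A" "?a z \<notin> B"
        using AB z by auto
      then obtain l where "l < z" "{?a l, ?a (Suc l)} \<in> E"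
        using cross[of 0 z] z by blast
      then show ?thesis
        by (intro bexI[of _ "{?a l, ?a (Suc l)}"]) simp_all
    qed
    then obtain f where f: "f \<in> E" "(\<forall>x\<in>f. fst (snd x) = t) \<or>
        (\<forall>x\<in>f. fst x = K - t) \<and> (\<forall>x\<in>f. snd (snd x) \<le> z)"
      by blast
    have "\<exists>g\<in>E. (\<forall>x\<in>g. snd (snd x) = t) \<or>
        (\<forall>x\<in>g. fst x = K - t) \<and> (\<exists>x\<in>g. z < snd (snd x))"
    proof (cases "?a t \<in> A")
      case True
      then have "?c 0 \<in> A"
        by simp
      then obtain l where "{?c l, ?c (Suc l)} \<in> E"
        using cross'' by blast
      then show ?thesis
        by (intro bexI[of _ "{?c l, ?c (Suc l)}"]) simp_all
    next
      case False
      then have "?a t \<in> B"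
        using AB row_a[of t] by auto
      then obtain l where "z \<le> l" "{?a l, ?a (Suc l)} \<in> E"
        using cross[of z t] z by blast
      then show ?thesis
        by (intro bexI[of _ "{?a l, ?a (Suc l)}"]) simp_all
    qed
    then obtain g where g: "g \<in> E" "(\<forall>x\<in>g. snd (snd x) = t) \<or>
        (\<forall>x\<in>g. fst x = K - t) \<and> (\<exists>x\<in>g. z < snd (snd x))"
      by blast
    have "f \<noteq> g"
    proof
      assume "f = g"
      obtain a b c a' b' c' where abc: "f = {(a, b, c), (a', b', c')}" "a + b + c = K"
          "a' + b' + c' = K" "(a, b, c) \<noteq> (a', b', c')"
        using E_cases[OF f(1)] by blast
      have "b = t \<and> b' = t \<or> a = K - t \<and> a' = K - t \<and> c \<le> z \<and> c' \<le> z"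
        using f(2) unfolding abc(1) by simp
      moreover have "c = t \<and> c' = t \<or> a = K - t \<and> a' = K - t \<and> (z < c \<or> z < c')"
        using g(2) unfolding \<open>f = g\<close>[symmetric] abc(1) by simp
      ultimately have "a = a' \<and> b = b' \<and> c = c'"
        using abc(2,3) by (elim disjE) auto
      then show False
        using abc(4) by simp
    qed
    moreover have "f \<in> F t" "g \<in> F t"
      using f g by (auto simp: F_def)
    moreover have "finite (F t)"
      using finE by (simp add: F_def)
    ultimately show ?thesis
      using card_mono[of "F t" "{f, g}"] by simp
  qed
  have disj: "F t \<inter> F t' = {}" if "t \<le> s" "t' \<le> s" "t \<noteq> t'" for t t'
  proof (rule ccontr)
    assume "F t \<inter> F t' \<noteq> {}"
    then obtain f where f: "f \<in> F t" "f \<in> F t'"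
      by blast
    have "t \<le> K" "t' \<le> K"
      using that s by (simp_all add: K_def)
    then have "K - t \<noteq> K - t'"
      using \<open>t \<noteq> t'\<close> by linarith
    obtain a b c a' b' c' where abc: "f = {(a, b, c), (a', b', c')}" "a + b + c = K"
        "a' + b' + c' = K" "(a, b, c) \<noteq> (a', b', c')"
      using E_cases[of f] f unfolding F_def by blast
    have "a = K - t \<and> a' = K - t \<or> b = t \<and> b' = t \<or> c = t \<and> c' = t"
      "a = K - t' \<and> a' = K - t' \<or> b = t' \<and> b' = t' \<or> c = t' \<and> c' = t'"
      using f unfolding F_def abc(1) by simp_all
    \<comment> \<open>Rows of one kind with different indices are disjoint, and rows of different
      kinds share at most one vertex, since two coordinates determine the third. So an edge cannot
      lie in rows of both indices. Here \<open>u\<close> and \<open>v\<close> abstract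
      \<open>K - t\<close> and \<open>K - t'\<close>.\<close>
    moreover have "u = a \<and> u = a' \<or> t = b \<and> t = b' \<or> t = c \<and> t = c' \<Longrightarrow>
        v = a \<and> v = a' \<or> t' = b \<and> t' = b' \<or> t' = c \<and> t' = c' \<Longrightarrow> u \<noteq> v \<Longrightarrow>
        a = a' \<and> b = b' \<and> c = c'" for u v
      using \<open>t \<noteq> t'\<close> abc(2,3) by (elim disjE) simp_all
    ultimately have "a = a' \<and> b = b' \<and> c = c'"
      using \<open>K - t \<noteq> K - t'\<close> by metis
    then show False
      using abc(4) by simp
  qed
  have "2 * (s + 1) = (\<Sum>t\<le>s. 2)"
    by simp
  also have "\<dots> \<le> (\<Sum>t\<le>s. card (F t))"
    using two by (intro sum_mono) simp
  also have "\<dots> = card (\<Union>t\<le>s. F t)"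
    using disj finE by (intro card_UN_disjoint[symmetric]) (auto simp: F_def)
  also have "\<dots> \<le> card E"
    using finE by (intro card_mono) (auto simp: F_def)
  finally show ?thesis
    by (simp add: E_def)
qed

text \<open>A discrete intermediate value argument on a walk from \<open>x\<close> to
  \<open>y\<close> inside the side: as long as level \<open>t\<close> has not been met, the walk is
  strictly below it.\<close>

lemma side_meets_level:
  fixes g :: "'a \<Rightarrow> nat"
  assumes xy: "x \<in> side T u v" "y \<in> side T u v"
    and t: "g x \<le> t" "t \<le> g y"
    and step: "\<And>p q. {p, q} \<in> edges T \<Longrightarrow> g q \<le> g p + 1"
  shows "\<exists>w\<in>side T u v. g w = t"
proof -
  let ?R = "adj_rel (delete_edge T {u, v})"
  have "(x, y) \<in> ?R\<^sup>*"
    using side_eq_Image[OF xy(1)] xy(2) by blast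
  then have "g y < t \<or> (\<exists>w. (x, w) \<in> ?R\<^sup>* \<and> g w = t)"
  proof (induction rule: rtrancl_induct)
    case base
    then show ?case
      using t by (cases "g x = t") auto
  next
    case (step p q)
    have "g q \<le> g p + 1"
      using step.hyps assms(5) by (simp add: adj_rel_delete_edge)
    moreover have "(x, q) \<in> ?R\<^sup>*"
      using step.hyps by simp
    ultimately show ?case
      using step.IH by (cases "g q = t") auto
  qed
  then show ?thesis
    using t side_eq_Image[OF xy(1)] by auto
qed

lemma grid_adj_coord_le:
  assumes "grid_adj u v"
  shows "fst v \<le> fst u + 1" "fst (snd v) \<le> fst (snd u) + 1" "snd (snd v) \<le> snd (snd u) + 1"
proof -
  obtain a b c a' b' c' where "u = (a, b, c)" "v = (a', b', c')"
    by (cases u, cases v)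
  then show "fst v \<le> fst u + 1" "fst (snd v) \<le> fst (snd u) + 1" "snd (snd v) \<le> snd (snd u) + 1"
    using assms by (auto simp: grid_adj_iff)
qed

lemma edge_congestion_triangular_grid_ge:
  assumes k: "2 \<le> k" and sp: "spanning_tree T (triangular_grid k)"
  shows "2 * (k - 1 - (k - 1) div 3) \<le> edge_congestion (triangular_grid k) T"
proof -
  define K where "K = k - 1"
  have K: "1 \<le> K"
    using k by (simp add: K_def)
  have gv: "(a, b, c) \<in> grid_verts k \<longleftrightarrow> a + b + c = K" for a b c
    by (simp add: grid_verts_def K_def)
  have T: "tree T" and V: "verts T = grid_verts k"
    and sub: "edges T \<subseteq> edges (triangular_grid k)"
    using sp by (auto simp: spanning_tree_def subgraph_def)
  have finV: "finite (verts T)"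
    using finite_triangular_grid[of k] V by simp
  define C where "C = {(K, 0, 0), (0, K, 0), (0, 0, K)}"
  have C: "C \<subseteq> verts T" "card C = 3"
    using K by (auto simp: C_def V gv)
  obtain m where m: "m \<in> grid_verts k"
    "\<And>u. {m, u} \<in> edges T \<Longrightarrow> card (C \<inter> side T m u) \<le> 1"
    using tree_median[OF T finV C] V by auto
  have rotC: "(rot ^^ i) ` C = C" for i
  proof (induction i)
    case (Suc i)
    have "(rot ^^ Suc i) ` C = rot ` (rot ^^ i) ` C"
      by (simp add: image_comp)
    also have "\<dots> = C"
      unfolding Suc by (auto simp: C_def)
    finally show ?case .
  qed simp
  \<comment> \<open>The rotation brings the smallest coordinate of the median to the first place, so
    the three possibilities become one argument.\<close>
  have main: ?thesis if i: "fst ((rot ^^ i) m) \<le> K div 3" for i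
  proof -
    let ?r = "rot ^^ i"
    have "p \<in> C \<Longrightarrow> \<exists>x. x \<in> C \<and> ?r x = p" for p
      using rotC[of i] by (metis imageE)
    moreover have "(K, 0, 0) \<in> C" "(0, K, 0) \<in> C" "(0, 0, K) \<in> C"
      by (simp_all add: C_def)
    \<comment> \<open>These are the corners that the rotation sends to the standard ones.\<close>
    ultimately obtain x y z where xyz: "x \<in> C" "y \<in> C" "z \<in> C"
      and r: "?r x = (K, 0, 0)" "?r y = (0, K, 0)" "?r z = (0, 0, K)"
      by metis
    have "K div 3 < K"
      using K by simp
    then have "x \<noteq> m"
      using i r by auto
    then obtain u where u: "{m, u} \<in> edges T" "x \<in> side T m u"
      using in_some_side[OF T, of m x] m(1) xyz C V by blast
    let ?A = "side T m u" and ?B = "side T u m"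
    have AB: "?A \<union> ?B = grid_verts k" "?A \<inter> ?B = {}"
      using side_cover[OF T u(1)] side_disjoint[OF T u(1)] V by auto
    \<comment> \<open>By the choice of \<open>m\<close>, the branch that contains the corner
      \<open>x\<close> contains no other corner.\<close>
    have other: "w \<in> ?B" if w: "w \<in> C" "w \<noteq> x" for w
    proof (rule ccontr)
      assume "w \<notin> ?B"
      then have "{w, x} \<subseteq> C \<inter> ?A"
        using w u xyz AB C V by auto
      then have "2 \<le> card (C \<inter> ?A)"
        using card_mono[of "C \<inter> ?A" "{w, x}"] w by (simp add: C_def)
      then show False
        using m(2)[OF u(1)] by simp
    qed
    have yB: "y \<in> ?B" and zB: "z \<in> ?B"
      using other xyz r K by (metis Pair_inject not_one_le_zero)+
    have step: "fst (?r q) \<le> fst (?r p) + 1" "fst (snd (?r q)) \<le> fst (snd (?r p)) + 1"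
      "snd (snd (?r q)) \<le> snd (snd (?r p)) + 1" if "{p, q} \<in> edges T" for p q
    proof -
      have "{p, q} \<in> edges (triangular_grid k)"
        using that sub by blast
      then have "grid_adj (?r p) (?r q)"
        by (simp add: edge_triangular_grid_iff)
      then show "fst (?r q) \<le> fst (?r p) + 1" "fst (snd (?r q)) \<le> fst (snd (?r p)) + 1"
        "snd (snd (?r q)) \<le> snd (snd (?r p)) + 1"
        by (rule grid_adj_coord_le)+
    qed
    \<comment> \<open>The neighbour \<open>u\<close> and the corner \<open>x\<close> both lie in
      \<open>?A\<close>, so after rotation \<open>?A\<close> meets every level of the first
      coordinate from \<open>fst (?r u)\<close> to \<open>K\<close>.\<close>
    let ?s = "K - fst (?r u)"
    have uK: "fst (?r u) \<le> K"
    proof -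
      have "u \<in> grid_verts k"
        using AB(1) side_self[of u T m] by blast
      then have "?r u \<in> grid_verts k"
        by simp
      then show ?thesis
        by (cases "?r u") (simp add: gv)
    qed
    have img: "?r ` ?A \<union> ?r ` ?B = grid_verts k" "?r ` ?A \<inter> ?r ` ?B = {}"
    proof -
      have inj: "inj ?r"
        by (intro inj_fn injI) (metis rot_rot_rot)
      then show "?r ` ?A \<inter> ?r ` ?B = {}"
        using AB by (simp flip: image_Int)
      have "?r ` grid_verts k \<subseteq> grid_verts k"
        by auto
      then have "?r ` grid_verts k = grid_verts k"
        using inj finV V by (metis endo_inj_surj inj_on_subset subset_UNIV)
      then show "?r ` ?A \<union> ?r ` ?B = grid_verts k"
        using AB by (simp flip: image_Un)
    qed
    have "2 * (?s + 1) \<le> card (edges_between (triangular_grid k) (?r ` ?A) (?r ` ?B))"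
    proof (rule card_cut_ge[OF img])
      show "?s \<le> k - 1"
        by (simp add: K_def)
    next
      fix t assume "t \<le> ?s"
      then have "fst (?r u) \<le> k - 1 - t" "k - 1 - t \<le> fst (?r x)"
        using uK by (simp_all add: r K_def)
      then show "\<exists>w\<in>?r ` ?A. fst w = k - 1 - t"
        using side_meets_level[OF side_self u(2), of "\<lambda>w. fst (?r w)"] step(1) by auto
    next
      fix t assume t: "t \<le> ?s"
      then have "fst (snd (?r z)) \<le> t" "t \<le> fst (snd (?r y))"
        by (simp_all add: r)
      then show "\<exists>w\<in>?r ` ?B. fst (snd w) = t"
        using side_meets_level[OF zB yB, of "\<lambda>w. fst (snd (?r w))"] step(2) by auto
      have "snd (snd (?r y)) \<le> t" "t \<le> snd (snd (?r z))"
        using t by (simp_all add: r)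
      then show "\<exists>w\<in>?r ` ?B. snd (snd w) = t"
        using side_meets_level[OF yB zB, of "\<lambda>w. snd (snd (?r w))"] step(3) by auto
    qed
    also have "\<dots> \<le> card (edges_between (triangular_grid k) ?A ?B)"
      by (rule card_edges_between_funpow_rot)
    also have "\<dots> \<le> edge_congestion (triangular_grid k) T"
      using edge_congestion_ge[OF finite_edges_triangular_grid T u(1)] .
    finally have "2 * (?s + 1) \<le> edge_congestion (triangular_grid k) T" .
    \<comment> \<open>The first coordinate may grow by one from \<open>m\<close> to
      \<open>u\<close>; the summand 1 in \<open>?s + 1\<close> makes up for it.\<close>
    moreover have "K - K div 3 \<le> ?s + 1"
      using i step(1)[OF u(1)] by linarith
    ultimately show ?thesis
      by (simp add: K_def)
  qed
  obtain a b c where abc: "m = (a, b, c)" "a + b + c = K"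
    using m(1) by (cases m) (auto simp: gv)
  then have "a \<le> K div 3 \<or> b \<le> K div 3 \<or> c \<le> K div 3"
    by linarith
  moreover have "(rot ^^ 1) m = (b, c, a)" "(rot ^^ 2) m = (c, a, b)"
    using abc by (simp_all add: numeral_2_eq_2)
  ultimately show ?thesis
    using main[of 0] main[of 1] main[of 2] abc by auto
qed

section \<open>Trees given by a parent function\<close>

definition parent_tree :: "'a \<Rightarrow> 'a set \<Rightarrow> ('a \<Rightarrow> 'a) \<Rightarrow> 'a graph" where
  "parent_tree r V par = (V, (\<lambda>v. {v, par v}) ` (V - {r}))"

lemma parent_tree_edgeE:
  assumes "{x, y} \<in> edges (parent_tree r V par)"
  obtains "x \<in> V" "x \<noteq> r" "y = par x" | "y \<in> V" "y \<noteq> r" "x = par y"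
proof -
  obtain v where v: "v \<in> V" "v \<noteq> r" "{x, y} = {v, par v}"
    using assms by (auto simp: parent_tree_def)
  then have "x = v \<and> y = par v \<or> x = par v \<and> y = v"
    unfolding doubleton_eq_iff by blast
  then show thesis
    using that v by blast
qed

text \<open>Descending ranks lead every vertex to \<open>r\<close>. On a cycle, a vertex of maximal
  rank would have its parent as both of its neighbours.\<close>

lemma tree_parent_tree:
  fixes rk :: "'a \<Rightarrow> nat"
  assumes r: "r \<in> V" and par: "\<And>v. v \<in> V \<Longrightarrow> v \<noteq> r \<Longrightarrow> par v \<in> V"
    and rk: "\<And>v. v \<in> V \<Longrightarrow> v \<noteq> r \<Longrightarrow> rk (par v) < rk v"
  shows "tree (parent_tree r V par)"
proof -
  let ?T = "parent_tree r V par"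
  have verts: "verts ?T = V"
    by (simp add: parent_tree_def)
  have edge: "{v, par v} \<in> edges ?T" if "v \<in> V" "v \<noteq> r" for v
    using that by (simp add: parent_tree_def)
  have "simple_graph ?T"
  proof -
    have "v \<noteq> par v" if "v \<in> V" "v \<noteq> r" for v
      using rk[OF that] by auto
    then show ?thesis
      using par by (auto simp: simple_graph_def parent_tree_def)
  qed
  moreover have "connected_graph ?T"
  proof -
    have to_r: "(v, r) \<in> (adj_rel ?T)\<^sup>*" if "v \<in> V" for v
      using that
    proof (induction "rk v" arbitrary: v rule: less_induct)
      case less
      show ?case
      proof (cases "v = r")
        case False
        have "(par v, r) \<in> (adj_rel ?T)\<^sup>*"
          using less.hyps[OF rk par] less.prems False by simp
        moreover have "(v, par v) \<in> adj_rel ?T"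
          using edge[OF less.prems False] by (simp add: adj_rel_def)
        ultimately show ?thesis
          by (rule converse_rtrancl_into_rtrancl[rotated])
      qed simp
    qed
    have "(u, v) \<in> (adj_rel ?T)\<^sup>*" if "u \<in> V" "v \<in> V" for u v
      using rtrancl_trans[OF to_r[OF that(1)] sym_adj_rel_rtrancl[OF to_r[OF that(2)]]] .
    then show ?thesis
      using r unfolding connected_graph_def verts by blast
  qed
  moreover have "\<not> is_cycle ?T p" for p
  proof
    assume "is_cycle ?T p"
    then have len: "3 \<le> length p" and dist: "distinct p"
      and cyc: "\<And>i. i < length p \<Longrightarrow> {p ! i, p ! (Suc i mod length p)} \<in> edges ?T"
      by (auto simp: is_cycle_def)
    let ?n = "length p"
    have up: "y = par x" if "{x, y} \<in> edges ?T" "rk y \<le> rk x" for x y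
      using that(1)
    proof (cases rule: parent_tree_edgeE)
      case 2
      then show ?thesis
        using rk[of y] that(2) by simp
    qed
    have "\<exists>i<?n. \<forall>j<?n. rk (p ! j) \<le> rk (p ! i)"
    proof -
      let ?R = "(\<lambda>i. rk (p ! i)) ` {..<?n}"
      have "?R \<noteq> {}"
        using len by (auto simp: lessThan_empty_iff)
      then have "Max ?R \<in> ?R"
        by (intro Max_in) simp_all
      then obtain i where "i < ?n" "Max ?R = rk (p ! i)"
        by auto
      then show ?thesis
        by (metis Max_ge finite_imageI finite_lessThan imageI lessThan_iff)
    qed
    then obtain i where i: "i < ?n" "\<And>j. j < ?n \<Longrightarrow> rk (p ! j) \<le> rk (p ! i)"
      by blast
    \<comment> \<open>\<open>j\<close> and \<open>l\<close> are the successor and the predecessor of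
      \<open>i\<close> on the cycle.\<close>
    define j where "j = Suc i mod ?n"
    define l where "l = (if i = 0 then ?n - 1 else i - 1)"
    have "0 < ?n"
      using len by linarith
    then have j: "j < ?n"
      unfolding j_def by (rule mod_less_divisor)
    have l: "l < ?n" "Suc l mod ?n = i"
      using i(1) len by (auto simp: j_def l_def)
    have "j \<noteq> l"
      using i(1) len by (cases "Suc i = ?n") (auto simp: j_def l_def)
    have "p ! j = par (p ! i)"
      using up[OF cyc[OF i(1)]] i(2)[OF j] by (simp add: j_def)
    moreover have "{p ! i, p ! l} \<in> edges ?T"
      using cyc[OF l(1)] unfolding l(2) by (simp add: insert_commute)
    then have "p ! l = par (p ! i)"
      using up i(2)[OF l(1)] by blast
    ultimately show False
      using nth_eq_iff_index_eq[OF dist j l(1)] \<open>j \<noteq> l\<close> by simp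
  qed
  ultimately show ?thesis
    by (simp add: tree_def)
qed

text \<open>\<open>S\<close> is meant to be the set of descendants of \<open>v\<close>. Every tree
  edge except the one from \<open>v\<close> to its parent keeps membership in \<open>S\<close>,
  which identifies \<open>V \<inter> S\<close> with the side of \<open>v\<close> without computing
  components.\<close>

lemma parent_tree_congestion_le:
  assumes fin: "finite (edges G)" and T: "tree (parent_tree r V par)"
    and ne: "V \<noteq> {r}" "r \<in> V"
    and cut: "\<And>v. v \<in> V \<Longrightarrow> v \<noteq> r \<Longrightarrow> \<exists>S. v \<in> S \<and> par v \<notin> S \<and>
      (\<forall>w\<in>V - {r, v}. w \<in> S \<longleftrightarrow> par w \<in> S) \<and> card (edges_between G (V \<inter> S) (V - S)) \<le> M"
  shows "edge_congestion G (parent_tree r V par) \<le> M"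
proof -
  let ?T = "parent_tree r V par"
  have *: "card (edges_between G (side ?T (par v) v) (side ?T v (par v))) \<le> M"
    if v: "v \<in> V" "v \<noteq> r" for v
  proof -
    have e: "{par v, v} \<in> edges ?T"
      using v by (auto simp: parent_tree_def insert_commute)
    obtain S where S: "v \<in> S" "par v \<notin> S" "\<And>w. w \<in> V \<Longrightarrow> w \<noteq> r \<Longrightarrow> w \<noteq> v \<Longrightarrow> w \<in> S \<longleftrightarrow> par w \<in> S"
      and card: "card (edges_between G (V \<inter> S) (V - S)) \<le> M"
      using cut[OF v] by blast
    have closed: "x \<in> S \<longleftrightarrow> y \<in> S" if "{x, y} \<in> edges ?T" "{x, y} \<noteq> {par v, v}" for x y
      using that(1)
    proof (cases rule: parent_tree_edgeE)
      case 1
      then have "x \<noteq> v"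
        using that(2) by auto
      then show ?thesis
        using S(3) 1 by blast
    next
      case 2
      then have "y \<noteq> v"
        using that(2) by auto
      then show ?thesis
        using S(3) 2 by blast
    qed
    have A: "x \<in> S" if "x \<in> side ?T (par v) v" for x
      using that
    proof (induction rule: side_induct)
      case base
      show ?case by (rule S(1))
    next
      case (step x y)
      then show ?case
        using closed by blast
    qed
    have B: "x \<notin> S" if "x \<in> side ?T v (par v)" for x
      using that
    proof (induction rule: side_induct)
      case base
      show ?case by (rule S(2))
    next
      case (step x y)
      then have "{x, y} \<noteq> {par v, v}"
        by (simp add: insert_commute)
      then show ?case
        using closed step by blast
    qed
    have "side ?T (par v) v \<union> side ?T v (par v) = V"
      using side_cover[OF T e] by (simp add: parent_tree_def)
    then have "side ?T (par v) v = V \<inter> S" "side ?T v (par v) = V - S"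
      using A B by blast+
    then show ?thesis
      using card by simp
  qed
  show ?thesis
  proof (rule edge_congestion_le[OF fin T])
    show "edges ?T \<noteq> {}"
      using ne by (auto simp: parent_tree_def)
  next
    fix u v assume "{u, v} \<in> edges ?T"
    then show "card (edges_between G (side ?T u v) (side ?T v u)) \<le> M \<or>
        card (edges_between G (side ?T v u) (side ?T u v)) \<le> M"
      using * by (cases rule: parent_tree_edgeE) blast+
  qed
qed

section \<open>A pinwheel spanning tree of the triangular grid\<close>

definition sector :: "nat \<Rightarrow> nat \<Rightarrow> (nat \<times> nat \<times> nat) set" where
  "sector q k = {(a, b, c). a + b + c = k - 1 \<and> q \<le> a \<and> b < q}"

lemma sector_iff: "(a, b, c) \<in> sector q k \<longleftrightarrow> a + b + c = k - 1 \<and> q \<le> a \<and> b < q"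
  by (simp add: sector_def)

text \<open>The lower end of the spine, where the tree of the sector is attached to the
  rest.\<close>

definition sector_top :: "nat \<Rightarrow> nat \<Rightarrow> nat \<times> nat \<times> nat" where
  "sector_top q k = (q, q - 1, k - 2 * q)"

text \<open>The first case runs along a row towards the spine. The other two descend the spine,
  along the side \<open>c = 0\<close> and then along \<open>b = q - 1\<close>.\<close>

definition sector_parent :: "nat \<Rightarrow> nat \<times> nat \<times> nat \<Rightarrow> nat \<times> nat \<times> nat" where
  "sector_parent q = (\<lambda>(a, b, c).
     if b + 1 < q then if 0 < c then (a, b + 1, c - 1) else (a - 1, b + 1, 0)
     else (a - 1, b, c + 1))"

text \<open>A rank for \<open>sector_parent\<close>: it drops by two on the side
  \<open>c = 0\<close> where \<open>b + 1 < q\<close>, and by one in the other two cases.\<close>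

definition sector_height :: "nat \<Rightarrow> nat \<times> nat \<times> nat \<Rightarrow> nat" where
  "sector_height q = (\<lambda>(a, b, c). a + (q - b))"

lemma sector_subset: "sector q k \<subseteq> grid_verts k"
  by (auto simp: sector_def grid_verts_def)

lemma sector_parent_props:
  assumes q: "1 \<le> q" "3 * q \<le> k + 2" and u: "u \<in> sector q k" "u \<noteq> sector_top q k"
  shows "sector_parent q u \<in> sector q k" "grid_adj u (sector_parent q u)"
    "sector_height q (sector_parent q u) < sector_height q u"
proof -
  obtain a b c where abc: "u = (a, b, c)" by (cases u)
  have s: "a + b + c = k - 1" "q \<le> a" "b < q"
    using u(1) by (simp_all add: abc sector_iff)
  consider "b + 1 < q" "0 < c" | "b + 1 < q" "c = 0" | "b + 1 = q"
    using s by linarith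
  then have "sector_parent q u \<in> sector q k \<and> grid_adj u (sector_parent q u) \<and>
    sector_height q (sector_parent q u) < sector_height q u"
  proof cases
    case 1
    then have p: "sector_parent q (a, b, c) = (a, b + 1, c - 1)"
      by (simp add: sector_parent_def)
    have "a + (b + 1) + (c - 1) = k - 1" "c = c - 1 + 1" "a + (q - (b + 1)) < a + (q - b)"
      using 1 s by linarith+
    then show ?thesis
      using 1 s unfolding abc p sector_iff sector_height_def prod.case grid_adj_iff by blast
  next
    case 2
    then have p: "sector_parent q (a, b, c) = (a - 1, b + 1, 0)"
      by (simp add: sector_parent_def)
    \<comment> \<open>Here \<open>q \<ge> 2\<close> and
      \<open>a \<ge> k + 1 - q \<ge> 2 * q - 1\<close>, so the step down stays at or above level
      \<open>q\<close>.\<close>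
    have "a - 1 + (b + 1) + 0 = k - 1" "a = a - 1 + 1" "q \<le> a - 1"
      "a - 1 + (q - (b + 1)) < a + (q - b)"
      using 2 s q by linarith+
    then show ?thesis
      using 2 s unfolding abc p sector_iff sector_height_def prod.case grid_adj_iff by blast
  next
    case 3
    have "a \<noteq> q"
    proof
      assume "a = q"
      then have "c = k - 2 * q"
        using 3 s by linarith
      then show False
        using u(2) \<open>a = q\<close> 3 by (simp add: abc sector_top_def)
    qed
    have p: "sector_parent q (a, b, c) = (a - 1, b, c + 1)"
      using 3 by (simp add: sector_parent_def)
    have "a - 1 + b + (c + 1) = k - 1" "a = a - 1 + 1" "q \<le> a - 1"
      "a - 1 + (q - b) < a + (q - b)"
      using \<open>a \<noteq> q\<close> s q by linarith+
    then show ?thesis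
      using s unfolding abc p sector_iff sector_height_def prod.case grid_adj_iff by blast
  qed
  then show "sector_parent q u \<in> sector q k" "grid_adj u (sector_parent q u)"
    "sector_height q (sector_parent q u) < sector_height q u"
    by simp_all
qed

text \<open>Each vertex has at most two neighbours in each adjacent row. The vertex with
  \<open>j = 0\<close> lacks one of them, which pays for the single edge by which the row
  continues.\<close>

lemma card_line_cut_le:
  assumes "S = {(a, j, l) | j l. j \<le> b \<and> a + j + l = k - 1}"
  shows "card (edges_between (triangular_grid k) S (grid_verts k - S)) \<le> 4 * (b + 1)"
proof -
  define K where "K = k - 1"
  let ?E = "edges_between (triangular_grid k) S (grid_verts k - S)"
  let ?f1 = "\<lambda>j. {(a, j, K - a - j), (a - 1, j + 1, K - a - j)}"
  let ?f2 = "\<lambda>j. {(a, j, K - a - j), (a - 1, j, K - a - j + 1)}"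
  let ?f3 = "\<lambda>j. {(a, j, K - a - j), (a + 1, j, K - a - j - 1)}"
  let ?f4 = "\<lambda>j. {(a, j, K - a - j), (a + 1, j - 1, K - a - j)}"
  let ?e = "{(a, b, K - a - b), (a, b + 1, K - a - b - 1)}"
  let ?U = "?f1 ` {..b} \<union> ?f2 ` {..b} \<union> ?f3 ` {..b} \<union> ?f4 ` {1..b} \<union> {?e}"
  have "?E \<subseteq> ?U"
  proof
    fix f assume "f \<in> ?E"
    then obtain x y where f: "f = {x, y}" "x \<in> S" "y \<notin> S" "y \<in> grid_verts k" "grid_adj x y"
      unfolding edges_between_triangular_grid by blast
    obtain j l where x: "x = (a, j, l)" "j \<le> b" "a + j + l = K"
      using f(2) by (auto simp: assms K_def)
    obtain a' j' l' where y: "y = (a', j', l')" by (cases y)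
    have sum: "a' + j' + l' = K"
      using f(4) by (simp add: y grid_verts_def K_def)
    have notin: "a' = a \<Longrightarrow> b < j'"
      using f(3) sum by (auto simp: assms y K_def)
    have l: "l = K - a - j"
      using x(3) by simp
    consider "a = a' + 1" "j' = j + 1" "l = l'" | "a = a' + 1" "j = j'" "l' = l + 1" |
      "a' = a + 1" "j = j'" "l = l' + 1" | "a' = a + 1" "j = j' + 1" "l = l'" |
      "a = a'" "j = j' + 1" "l' = l + 1" | "a = a'" "j' = j + 1" "l = l' + 1"
      using f(5) unfolding x(1) y grid_adj_iff by blast
    then show "f \<in> ?U"
    proof cases
      case 1
      then have "f = ?f1 j" "j \<in> {..b}"
        using l x(2) by (simp_all add: f(1) x(1) y)
      then have "f \<in> ?f1 ` {..b}"
        by (rule image_eqI)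
      then show ?thesis
        unfolding Un_iff by blast
    next
      case 2
      then have "f = ?f2 j" "j \<in> {..b}"
        using l x(2) by (simp_all add: f(1) x(1) y)
      then have "f \<in> ?f2 ` {..b}"
        by (rule image_eqI)
      then show ?thesis
        unfolding Un_iff by blast
    next
      case 3
      then have "f = ?f3 j" "j \<in> {..b}"
        using l x(2) by (simp_all add: f(1) x(1) y)
      then have "f \<in> ?f3 ` {..b}"
        by (rule image_eqI)
      then show ?thesis
        unfolding Un_iff by blast
    next
      case 4
      then have "f = ?f4 j" "j \<in> {1..b}"
        using l x(2) by (simp_all add: f(1) x(1) y)
      then have "f \<in> ?f4 ` {1..b}"
        by (rule image_eqI)
      then show ?thesis
        unfolding Un_iff by blast
    next
      case 5
      then show ?thesis
        using notin x(2) by simp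
    next
      case 6
      then have "j = b"
        using notin x(2) by simp
      then have "f \<in> {?e}"
        using 6 l by (simp add: f(1) x(1) y)
      then show ?thesis
        unfolding Un_iff by blast
    qed
  qed
  then have "card ?E \<le> card ?U"
    by (intro card_mono) simp_all
  also have "\<dots> \<le> card (?f1 ` {..b}) + card (?f2 ` {..b}) + card (?f3 ` {..b}) + card (?f4 ` {1..b})
      + card {?e}"
    by (intro order_trans[OF card_Un_le] add_mono order_refl)
  also have "\<dots> \<le> card {..b} + card {..b} + card {..b} + card {1..b} + card {?e}"
    by (intro add_mono card_image_le order_refl) simp_all
  also have "\<dots> = 4 * (b + 1)"
    by simp
  finally show ?thesis .
qed

text \<open>Cut edges through the row \<open>i = a\<close> are charged to its vertices in
  \<open>S\<close>, the others to the vertices with \<open>j = q\<close> and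
  \<open>i \<ge> a\<close> just outside. Each receives at most two edges, and there are
  \<open>k - a\<close> of them whether the region is a trapezoid or a whole triangle.\<close>

lemma card_trapezoid_cut_le:
  assumes S: "S = {(i, j, l). i + j + l = k - 1 \<and> a \<le> i \<and> j < q}" and a: "a \<le> k - 1"
    and k: "1 \<le> k"
  shows "card (edges_between (triangular_grid k) S (grid_verts k - S)) \<le> 2 * (k - a)"
proof -
  define K where "K = k - 1"
  let ?E = "edges_between (triangular_grid k) S (grid_verts k - S)"
  let ?m = "min q (K + 1 - a)"
  let ?I = "{a..<K + 1 - q}"
  let ?f1 = "\<lambda>j. {(a, j, K - a - j), (a - 1, j + 1, K - a - j)}"
  let ?f2 = "\<lambda>j. {(a, j, K - a - j), (a - 1, j, K - a - j + 1)}"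
  let ?f3 = "\<lambda>i. {(i, q - 1, K - i - (q - 1)), (i, q, K - i - q)}"
  let ?f4 = "\<lambda>i. {(i + 1, q - 1, K - i - q), (i, q, K - i - q)}"
  let ?U = "?f1 ` {..<?m} \<union> ?f2 ` {..<?m} \<union> ?f3 ` ?I \<union> ?f4 ` ?I"
  have "?E \<subseteq> ?U"
  proof
    fix f assume "f \<in> ?E"
    then obtain x y where f: "f = {x, y}" "x \<in> S" "y \<notin> S" "y \<in> grid_verts k" "grid_adj x y"
      unfolding edges_between_triangular_grid by blast
    obtain i j l where x: "x = (i, j, l)" "a \<le> i" "j < q" "i + j + l = K"
      using f(2) by (auto simp: S K_def)
    obtain i' j' l' where y: "y = (i', j', l')" by (cases y)
    have sum: "i' + j' + l' = K"
      using f(4) by (simp add: y grid_verts_def K_def)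
    have notin: "a \<le> i' \<Longrightarrow> q \<le> j'"
      using f(3) sum by (auto simp: S y K_def)
    have l: "l = K - i - j"
      using x(4) by simp
    consider "i = i' + 1" "j' = j + 1" "l = l'" | "i = i' + 1" "j = j'" "l' = l + 1" |
      "i' = i + 1" "j' \<le> j" | "i = i'" "j = j' + 1" | "i = i'" "j' = j + 1" "l = l' + 1"
      using f(5) unfolding x(1) y grid_adj_iff by force
    then show "f \<in> ?U"
    proof cases
      case 1
      show ?thesis
      proof (cases "i = a")
        case True
        then have "f = ?f1 j" "j \<in> {..<?m}"
          using 1 l x by (auto simp: f(1) x(1) y)
        then have "f \<in> ?f1 ` {..<?m}"
          by (rule image_eqI)
        then show ?thesis
          unfolding Un_iff by blast
      next
        case False
        then have "j + 1 = q"
          using notin 1 x by simp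
        then have "f = ?f4 i'" "i' \<in> ?I"
          using 1 l x False by (auto simp: f(1) x(1) y)
        then have "f \<in> ?f4 ` ?I"
          by (rule image_eqI)
        then show ?thesis
          unfolding Un_iff by blast
      qed
    next
      case 2
      then have "i = a"
        using notin x by fastforce
      then have "f = ?f2 j" "j \<in> {..<?m}"
        using 2 l x by (auto simp: f(1) x(1) y)
      then have "f \<in> ?f2 ` {..<?m}"
        by (rule image_eqI)
      then show ?thesis
        unfolding Un_iff by blast
    next
      case 3
      then show ?thesis
        using notin x by simp
    next
      case 4
      then show ?thesis
        using notin x by simp
    next
      case 5
      then have "j + 1 = q"
        using notin x by simp
      then have "f = ?f3 i" "i \<in> ?I"
        using 5 l x by (auto simp: f(1) x(1) y)
      then have "f \<in> ?f3 ` ?I"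
        by (rule image_eqI)
      then show ?thesis
        unfolding Un_iff by blast
    qed
  qed
  then have "card ?E \<le> card ?U"
    by (intro card_mono) simp_all
  also have "\<dots> \<le> card (?f1 ` {..<?m}) + card (?f2 ` {..<?m}) + card (?f3 ` ?I) + card (?f4 ` ?I)"
    by (intro order_trans[OF card_Un_le] add_mono order_refl)
  also have "\<dots> \<le> card {..<?m} + card {..<?m} + card ?I + card ?I"
    by (intro add_mono card_image_le) simp_all
  also have "\<dots> = 2 * (?m + (K + 1 - q - a))"
    by simp
  also have "?m + (K + 1 - q - a) = K + 1 - a"
    by linarith
  finally show ?thesis
    using k by (simp add: K_def)
qed

text \<open>\<open>S\<close> consists of the descendants of \<open>u\<close>: part of a row if
  \<open>u\<close> is off the spine, and otherwise the part of the sector from level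
  \<open>a\<close> upwards. In the first case the cut has at most \<open>4 * (q - 1)\<close> edges,
  and \<open>3 * q \<le> k + 2\<close> turns this into the common bound.\<close>

lemma sector_subtree:
  assumes q: "1 \<le> q" "3 * q \<le> k + 2" and u: "u \<in> sector q k"
  shows "\<exists>S\<subseteq>sector q k. u \<in> S \<and> (sector_top q k \<in> S \<longrightarrow> u = sector_top q k) \<and>
    (u \<noteq> sector_top q k \<longrightarrow> sector_parent q u \<notin> S) \<and>
    (\<forall>w\<in>sector q k. w \<noteq> sector_top q k \<longrightarrow> w \<noteq> u \<longrightarrow> (w \<in> S \<longleftrightarrow> sector_parent q w \<in> S)) \<and>
    card (edges_between (triangular_grid k) S (grid_verts k - S)) \<le> 2 * (k - q)"
proof -
  obtain a b c where abc: "u = (a, b, c)" by (cases u)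
  have s: "a + b + c = k - 1" "q \<le> a" "b < q"
    using u(1) by (simp_all add: abc sector_iff)
  show ?thesis
  proof (cases "b + 1 < q \<and> 0 < c")
    case True
    let ?S = "{(a, j, l) | j l. j \<le> b \<and> a + j + l = k - 1}"
    have mem: "(i, j, l) \<in> ?S \<longleftrightarrow> i = a \<and> j \<le> b \<and> a + j + l = k - 1" for i j l
      by auto
    have closed: "w \<in> ?S \<longleftrightarrow> sector_parent q w \<in> ?S" if w: "w \<in> sector q k" "w \<noteq> u" for w
    proof -
      obtain i j l where ijl: "w = (i, j, l)" by (cases w)
      have t: "i + j + l = k - 1" "q \<le> i" "j < q" "i = a \<Longrightarrow> j \<noteq> b"
        using w s by (auto simp: abc ijl sector_iff)
      consider "j + 1 < q" "0 < l" | "j + 1 < q" "l = 0" | "j + 1 = q"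
        using t by linarith
      then show ?thesis
      proof cases
        case 1
        then show ?thesis
          using t True by (auto simp: ijl sector_parent_def mem)
      next
        case 2
        \<comment> \<open>As \<open>c > 0\<close>, the part of the row avoids the side
          \<open>c = 0\<close>, which contains both \<open>w\<close> and its parent.\<close>
        have "\<not> (j \<le> b \<and> a + j + 0 = k - 1)" "\<not> (j + 1 \<le> b \<and> a + (j + 1) + 0 = k - 1)"
          using s(1) True by (intro notI; elim conjE; linarith)+
        moreover have "sector_parent q w = (i - 1, j + 1, 0)"
          using 2 by (simp add: ijl sector_parent_def)
        ultimately show ?thesis
          using 2(2) unfolding ijl by (simp only: mem) blast
      next
        case 3
        then have "\<not> j \<le> b"
          using True by linarith
        then show ?thesis
          using 3 by (simp add: ijl sector_parent_def mem)
      qed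
    qed
    have "card (edges_between (triangular_grid k) ?S (grid_verts k - ?S)) \<le> 4 * (b + 1)"
      by (rule card_line_cut_le) simp
    also have "4 * (b + 1) \<le> 4 * (q - 1)"
      using True by (intro mult_le_mono2) linarith
    also have "\<dots> \<le> 2 * (k - q)"
      using q by linarith
    finally have card: "card (edges_between (triangular_grid k) ?S (grid_verts k - ?S)) \<le> 2 * (k - q)" .
    have sub: "?S \<subseteq> sector q k"
      using s by (auto simp: sector_def)
    have uS: "u \<in> ?S"
      using s by (simp add: abc)
    have "\<not> q - 1 \<le> b"
      using True by linarith
    then have top: "u = sector_top q k" if "sector_top q k \<in> ?S"
      using that by (simp add: sector_top_def)
    have par: "sector_parent q u \<notin> ?S"
      using True by (simp add: abc sector_parent_def)
    show ?thesis
      by (intro exI[of _ ?S] conjI impI ballI sub uS par card) (rule top closed; assumption)+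
  next
    case False
    let ?S = "{(i, j, l). i + j + l = k - 1 \<and> a \<le> i \<and> j < q}"
    have bc: "b + 1 = q \<or> c = 0"
      using False s by linarith
    have mem: "(i, j, l) \<in> ?S \<longleftrightarrow> i + j + l = k - 1 \<and> a \<le> i \<and> j < q" for i j l
      by auto
    have closed: "w \<in> ?S \<longleftrightarrow> sector_parent q w \<in> ?S" if w: "w \<in> sector q k" "w \<noteq> u" for w
    proof -
      obtain i j l where ijl: "w = (i, j, l)" by (cases w)
      have t: "i + j + l = k - 1" "q \<le> i" "j < q" "\<not> (i = a \<and> j = b)"
        using w s by (auto simp: abc ijl sector_iff)
      consider "j + 1 < q" "0 < l" | "j + 1 < q" "l = 0" | "j + 1 = q"
        using t by linarith
      then show ?thesis
      proof cases
        case 1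
        then have p: "sector_parent q (i, j, l) = (i, j + 1, l - 1)"
          by (simp add: sector_parent_def)
        have "i + (j + 1) + (l - 1) = k - 1"
          using 1 t by linarith
        then show ?thesis
          unfolding ijl p mem using 1 t by blast
      next
        case 2
        \<comment> \<open>The vertex \<open>u\<close> is the only spine vertex of its row, so no
          other spine edge crosses the threshold \<open>a\<close>.\<close>
        then have "i \<noteq> a"
          using t s bc by linarith
        then have "a \<le> i \<longleftrightarrow> a \<le> i - 1"
          using t q by linarith
        moreover have p: "sector_parent q (i, j, l) = (i - 1, j + 1, 0)"
          using 2 by (simp add: sector_parent_def)
        moreover have "i - 1 + (j + 1) + 0 = k - 1"
          using 2 t q by linarith
        ultimately show ?thesis
          unfolding ijl p mem using 2 t by blast
      next
        case 3
        then have "i \<noteq> a"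
          using t s bc by linarith
        then have "a \<le> i \<longleftrightarrow> a \<le> i - 1"
          using t q by linarith
        moreover have p: "sector_parent q (i, j, l) = (i - 1, j, l + 1)"
          using 3 by (simp add: sector_parent_def)
        moreover have "i - 1 + j + (l + 1) = k - 1"
          using t q by linarith
        ultimately show ?thesis
          unfolding ijl p mem using t by blast
      qed
    qed
    have k: "1 \<le> k"
      using q by linarith
    have "card (edges_between (triangular_grid k) ?S (grid_verts k - ?S)) \<le> 2 * (k - a)"
      using s k by (intro card_trapezoid_cut_le) simp_all
    also have "\<dots> \<le> 2 * (k - q)"
      using s by (intro mult_le_mono2) linarith
    finally have card: "card (edges_between (triangular_grid k) ?S (grid_verts k - ?S)) \<le> 2 * (k - q)" .
    have sub: "?S \<subseteq> sector q k"
      using s by (auto simp: sector_def)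
    have uS: "u \<in> ?S"
      using s by (simp add: abc)
    have top: "u = sector_top q k" if "sector_top q k \<in> ?S"
    proof -
      have "a = q"
        using that s by (simp add: sector_top_def)
      moreover from this have "b = q - 1"
        using bc s q by linarith
      moreover from calculation have "c = k - 2 * q"
        using s q by linarith
      ultimately show ?thesis
        by (simp add: abc sector_top_def)
    qed
    have par: "sector_parent q u \<notin> ?S"
      using bc s q by (auto simp: abc sector_parent_def)
    show ?thesis
      by (intro exI[of _ ?S] conjI impI ballI sub uS par card) (rule top closed; assumption)+
  qed
qed

section \<open>Joining the three sectors at a root\<close>

lemma funpow_rot_2: "(rot ^^ 2) v = rot (rot v)"
  by (simp add: numeral_2_eq_2)

text \<open>If \<open>k + 2 = 3 * q\<close>, the central vertex lies in none of the sectors and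
  becomes the root. Otherwise one of the three tops does.\<close>

definition grid_root :: "nat \<Rightarrow> nat \<Rightarrow> nat \<times> nat \<times> nat" where
  "grid_root q k = (if k + 2 = 3 * q then (q - 1, q - 1, q - 1) else sector_top q k)"

lemma sector_top_in_sector:
  assumes "1 \<le> q" "2 \<le> k" "3 * q \<le> k + 2"
  shows "sector_top q k \<in> sector q k"
proof -
  have "q + (q - 1) + (k - 2 * q) = k - 1" "q - 1 < q"
    using assms by linarith+
  then show ?thesis
    by (simp add: sector_top_def sector_iff)
qed

lemma grid_root_in_grid:
  assumes "1 \<le> q" "2 \<le> k" "3 * q \<le> k + 2"
  shows "grid_root q k \<in> grid_verts k"
proof (cases "k + 2 = 3 * q")
  case True
  then have "q - 1 + (q - 1) + (q - 1) = k - 1"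
    using assms by linarith
  then show ?thesis
    using True by (simp add: grid_root_def grid_verts_def)
next
  case False
  then show ?thesis
    using sector_top_in_sector[OF assms] sector_subset by (auto simp: grid_root_def)
qed

text \<open>For any two of the rotated sectors, some coordinate is at least \<open>q\<close> in one
  and below \<open>q\<close> in the other.\<close>

lemma rot_sectors_disjoint:
  assumes "i < 3" "j < 3" "u \<in> sector q k" "v \<in> sector q k" "(rot ^^ i) u = (rot ^^ j) v"
  shows "i = j \<and> u = v"
proof -
  obtain a b c where u: "u = (a, b, c)" by (cases u)
  obtain a' b' c' where v: "v = (a', b', c')" by (cases v)
  have le: "q \<le> a" "b < q" "q \<le> a'" "b' < q"
    using assms(3,4) by (simp_all add: u v sector_iff)
  have "i = 0 \<or> i = 1 \<or> i = 2" "j = 0 \<or> j = 1 \<or> j = 2"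
    using assms(1,2) by linarith+
  then show ?thesis
    using assms(5) le unfolding u v
    by (elim disjE) (auto simp: funpow_rot_2)
qed

text \<open>Not all coordinates are at least \<open>q\<close>, and they are all below
  \<open>q\<close> only at the centre. So in cyclic order some coordinate that is at least
  \<open>q\<close> is followed by one below \<open>q\<close>.\<close>

lemma rot_sectors_cover:
  assumes q: "1 \<le> q" "3 * q \<le> k + 2" "k \<le> 3 * q"
    and v: "v \<in> grid_verts k" "v \<noteq> grid_root q k"
  obtains i u where "i < 3" "u \<in> sector q k" "v = (rot ^^ i) u"
proof -
  obtain a b c where abc: "v = (a, b, c)" by (cases v)
  have sum: "a + b + c = k - 1"
    using v(1) by (simp add: abc grid_verts_def)
  have "\<not> (q \<le> a \<and> q \<le> b \<and> q \<le> c)"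
    using sum q by linarith
  moreover have "\<not> (a < q \<and> b < q \<and> c < q)"
  proof
    assume *: "a < q \<and> b < q \<and> c < q"
    then have "k + 2 = 3 * q" "a = q - 1" "b = q - 1" "c = q - 1"
      using sum q by linarith+
    then show False
      using v(2) by (simp add: abc grid_root_def)
  qed
  ultimately consider "q \<le> a" "b < q" | "q \<le> b" "c < q" | "q \<le> c" "a < q"
    by linarith
  then show thesis
  proof cases
    case 1
    then show thesis
      using that[of 0 "(a, b, c)"] sum by (simp add: abc sector_iff)
  next
    case 2
    then show thesis
      using that[of 2 "(b, c, a)"] sum by (simp add: abc sector_iff funpow_rot_2)
  next
    case 3
    then show thesis
      using that[of 1 "(c, a, b)"] sum by (simp add: abc sector_iff)
  qed
qed

lemma grid_root_in_rot_sector: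
  assumes "1 \<le> q" "2 \<le> k" "3 * q \<le> k + 2"
    and "i < 3" "u \<in> sector q k" "(rot ^^ i) u = grid_root q k"
  shows "i = 0 \<and> u = sector_top q k"
proof (cases "k + 2 = 3 * q")
  case True
  obtain a b c where u: "u = (a, b, c)" by (cases u)
  have "q \<le> a"
    using assms(5) by (simp add: u sector_iff)
  have "i = 0 \<or> i = 1 \<or> i = 2"
    using assms(4) by linarith
  then have "a = q - 1"
    using assms(6) True unfolding u grid_root_def by (auto simp: funpow_rot_2)
  then show ?thesis
    using \<open>q \<le> a\<close> assms(1) by simp
next
  case False
  then have "(rot ^^ i) u = (rot ^^ 0) (sector_top q k)"
    using assms(6) by (simp add: grid_root_def)
  then show ?thesis
    using rot_sectors_disjoint[of i 0] assms(4,5) sector_top_in_sector[OF assms(1-3)] by simp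
qed

text \<open>For \<open>k + 2 = 3 * q\<close> the tops surround the central vertex; in the two other
  cases they are the corners of a unit triangle.\<close>

lemma grid_adj_sector_top_root:
  assumes "1 \<le> q" "2 \<le> k" "3 * q \<le> k + 2" "k \<le> 3 * q" "i < 3"
    and ne: "(rot ^^ i) (sector_top q k) \<noteq> grid_root q k"
  shows "grid_adj ((rot ^^ i) (sector_top q k)) (grid_root q k)"
proof -
  obtain p where p: "q = Suc p"
    using assms(1) by (cases q) auto
  have i: "i = 0 \<or> i = 1 \<or> i = 2"
    using assms(5) by linarith
  consider "k + 2 = 3 * q" | "k + 1 = 3 * q" | "k = 3 * q"
    using assms(3,4) by linarith
  then show ?thesis
  proof cases
    case 1
    \<comment> \<open>\<open>k \<ge> 2\<close> excludes \<open>q = 1\<close> in this case, so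
      \<open>p - 1\<close> is a genuine predecessor.\<close>
    then obtain p' where "p = Suc p'"
      using assms(2) p by (cases p) auto
    then have "sector_top q k = (p + 1, p, p - 1)" "grid_root q k = (p, p, p)" "p = p - 1 + 1"
      using 1 p by (auto simp: sector_top_def grid_root_def)
    then show ?thesis
      using i by (elim disjE) (simp_all add: funpow_rot_2 grid_adj_iff)
  next
    case 2
    then have "sector_top q k = (p + 1, p, p)" "grid_root q k = (p + 1, p, p)"
      using p by (auto simp: sector_top_def grid_root_def)
    then show ?thesis
      using i ne by (elim disjE) (simp_all add: funpow_rot_2 grid_adj_iff)
  next
    case 3
    then have "sector_top q k = (p + 1, p, p + 1)" "grid_root q k = (p + 1, p, p + 1)"
      using p by (auto simp: sector_top_def grid_root_def)
    then show ?thesis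
      using i ne by (elim disjE) (simp_all add: funpow_rot_2 grid_adj_iff)
  qed
qed

text \<open>Inverts the map from \<open>(i, u)\<close> to \<open>(rot ^^ i) u\<close>; disjointness
  of the sectors makes the choice unique wherever a pair exists.\<close>

definition sector_coords :: "nat \<Rightarrow> nat \<Rightarrow> nat \<times> nat \<times> nat \<Rightarrow> nat \<times> nat \<times> nat \<times> nat" where
  "sector_coords q k v = (SOME (i, u). i < 3 \<and> u \<in> sector q k \<and> v = (rot ^^ i) u)"

lemma sector_coords_eq:
  assumes "i < 3" "u \<in> sector q k"
  shows "sector_coords q k ((rot ^^ i) u) = (i, u)"
  unfolding sector_coords_def
proof (rule some_equality)
  show "case (i, u) of (i', u') \<Rightarrow> i' < 3 \<and> u' \<in> sector q k \<and> (rot ^^ i) u = (rot ^^ i') u'"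
    using assms by simp
next
  fix p assume "case p of (i', u') \<Rightarrow> i' < 3 \<and> u' \<in> sector q k \<and> (rot ^^ i) u = (rot ^^ i') u'"
  then show "p = (i, u)"
    using rot_sectors_disjoint[of i _ u q k] assms by (cases p) fastforce
qed

definition grid_parent :: "nat \<Rightarrow> nat \<Rightarrow> nat \<times> nat \<times> nat \<Rightarrow> nat \<times> nat \<times> nat" where
  "grid_parent q k v = (case sector_coords q k v of (i, u) \<Rightarrow>
     if u = sector_top q k then grid_root q k else (rot ^^ i) (sector_parent q u))"

lemma grid_parent_eq:
  assumes "i < 3" "u \<in> sector q k"
  shows "grid_parent q k ((rot ^^ i) u) =
    (if u = sector_top q k then grid_root q k else (rot ^^ i) (sector_parent q u))"
  unfolding grid_parent_def sector_coords_eq[OF assms] prod.case ..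

lemma ex_spanning_tree_triangular_grid:
  assumes q: "1 \<le> q" "2 \<le> k" "3 * q \<le> k + 2" "k \<le> 3 * q"
  shows "\<exists>T. spanning_tree T (triangular_grid k) \<and> edge_congestion (triangular_grid k) T \<le> 2 * (k - q)"
proof -
  let ?G = "triangular_grid k" and ?V = "grid_verts k"
  let ?r = "grid_root q k" and ?top = "sector_top q k" and ?par = "grid_parent q k"
  let ?T = "parent_tree ?r ?V ?par"
  \<comment> \<open>Rank 0 at the root, even if the root is a top, lets the edges from the tops to
    the root descend as well.\<close>
  define rk where "rk v = (if v = ?r then 0 else
    1 + (case sector_coords q k v of (i, u) \<Rightarrow> sector_height q u))" for v
  note cover = rot_sectors_cover[OF q(1,3,4)]
  note props = sector_parent_props[OF q(1,3)]
  have r: "?r \<in> ?V"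
    by (rule grid_root_in_grid[OF q(1-3)])
  have par: "?par v \<in> ?V \<and> grid_adj v (?par v) \<and> rk (?par v) < rk v"
    if v: "v \<in> ?V" "v \<noteq> ?r" for v
  proof -
    obtain i u where iu: "i < 3" "u \<in> sector q k" "v = (rot ^^ i) u"
      by (rule cover[OF v])
    have rkv: "rk v = 1 + sector_height q u"
      using v(2) unfolding rk_def iu(3) sector_coords_eq[OF iu(1,2)] by simp
    show ?thesis
    proof (cases "u = ?top")
      case True
      then have "?par v = ?r"
        using grid_parent_eq[OF iu(1,2)] iu(3) by simp
      moreover have "grid_adj v ?r"
        using grid_adj_sector_top_root[OF q iu(1)] v(2) iu(3) True by simp
      ultimately show ?thesis
        using r rkv by (simp add: rk_def)
    next
      case False
      then have p: "?par v = (rot ^^ i) (sector_parent q u)"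
        using grid_parent_eq[OF iu(1,2)] iu(3) by simp
      note pr = props[OF iu(2) False]
      have "?par v \<in> ?V"
        using pr(1) sector_subset unfolding p by auto
      moreover have "grid_adj v (?par v)"
        unfolding p unfolding iu(3) using pr(2) by simp
      moreover have "rk (?par v) \<le> 1 + sector_height q (sector_parent q u)"
        unfolding rk_def p sector_coords_eq[OF iu(1) pr(1)] by simp
      ultimately show ?thesis
        using pr(3) rkv by simp
    qed
  qed
  have tree: "tree ?T"
    using par by (intro tree_parent_tree[where rk = rk] r) simp_all
  have "edges ?T \<subseteq> edges ?G"
  proof
    fix e assume "e \<in> edges ?T"
    then obtain v where v: "v \<in> ?V" "v \<noteq> ?r" "e = {v, ?par v}"
      by (auto simp: parent_tree_def)
    then show "e \<in> edges ?G"
      using par[OF v(1,2)] by (simp add: edge_triangular_grid_iff)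
  qed
  then have "spanning_tree ?T ?G"
    using tree by (simp add: spanning_tree_def subgraph_def tree_def parent_tree_def)
  moreover have "edge_congestion ?G ?T \<le> 2 * (k - q)"
  proof (rule parent_tree_congestion_le[OF finite_edges_triangular_grid tree _ r])
    have "(k - 1, 0, 0) \<in> ?V" "(0, k - 1, 0) \<in> ?V" "k - 1 \<noteq> 0"
      using q(2) by (simp_all add: grid_verts_def)
    then show "?V \<noteq> {?r}"
      by (metis Pair_inject singletonD)
  next
    fix v assume v: "v \<in> ?V" "v \<noteq> ?r"
    obtain i u where iu: "i < 3" "u \<in> sector q k" "v = (rot ^^ i) u"
      by (rule cover[OF v])
    obtain S where S: "S \<subseteq> sector q k" "u \<in> S" "?top \<in> S \<Longrightarrow> u = ?top"
      "u \<noteq> ?top \<Longrightarrow> sector_parent q u \<notin> S"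
      "\<And>w. w \<in> sector q k \<Longrightarrow> w \<noteq> ?top \<Longrightarrow> w \<noteq> u \<Longrightarrow> w \<in> S \<longleftrightarrow> sector_parent q w \<in> S"
      and card: "card (edges_between ?G S (?V - S)) \<le> 2 * (k - q)"
      using sector_subtree[OF q(1,3) iu(2)] by blast
    let ?S = "(rot ^^ i) ` S"
    have inj: "inj (rot ^^ i)"
      by (intro inj_fn injI) (metis rot_rot_rot)
    have mem: "(rot ^^ j) w \<in> ?S \<longleftrightarrow> j = i \<and> w \<in> S" if "j < 3" "w \<in> sector q k" for j w
    proof
      assume "(rot ^^ j) w \<in> ?S"
      then obtain x where "x \<in> S" "(rot ^^ j) w = (rot ^^ i) x"
        by blast
      then show "j = i \<and> w \<in> S"
        using rot_sectors_disjoint[OF that(1) iu(1) that(2)] S(1) by blast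
    qed simp
    \<comment> \<open>The root could lie in \<open>?S\<close> only as the top of the unrotated
      sector, but then \<open>u\<close> would be that top and \<open>v\<close> the root.\<close>
    have root: "?r \<notin> ?S"
    proof
      assume "?r \<in> ?S"
      then obtain w where w: "w \<in> S" "(rot ^^ i) w = ?r"
        by auto
      then have "i = 0 \<and> w = ?top"
        using grid_root_in_rot_sector[OF q(1-3) iu(1)] S(1) by blast
      then show False
        using S(3) w iu(3) v(2) by simp
    qed
    have "v \<in> ?S"
      using iu(3) S(2) by simp
    moreover have "?par v \<notin> ?S"
    proof (cases "u = ?top")
      case True
      then show ?thesis
        using root grid_parent_eq[OF iu(1,2)] iu(3) by simp
    next
      case False
      then show ?thesis
        using mem[OF iu(1) props(1)[OF iu(2) False]] S(4) grid_parent_eq[OF iu(1,2)] iu(3) by simp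
    qed
    moreover have "w \<in> ?S \<longleftrightarrow> ?par w \<in> ?S" if w: "w \<in> ?V - {?r, v}" for w
    proof -
      have w': "w \<in> ?V" "w \<noteq> ?r" "w \<noteq> v"
        using w by simp_all
      obtain j x where jx: "j < 3" "x \<in> sector q k" "w = (rot ^^ j) x"
        by (rule cover[OF w'(1,2)])
      have x: "j = i \<Longrightarrow> x \<noteq> u"
        using w'(3) iu(3) jx(3) by auto
      show ?thesis
      proof (cases "x = ?top")
        case True
        \<comment> \<open>A top lies in \<open>?S\<close> only if it is \<open>v\<close>, and its
          parent is the root, so this edge does not cross the cut.\<close>
        then have "w \<notin> ?S"
          using mem[OF jx(1,2)] S(3) x jx(3) by auto
        then show ?thesis
          using root True grid_parent_eq[OF jx(1,2)] jx(3) by simp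
      next
        case False
        then have "?par w = (rot ^^ j) (sector_parent q x)"
          using grid_parent_eq[OF jx(1,2)] jx(3) by simp
        then show ?thesis
          using mem[OF jx(1,2)] mem[OF jx(1) props(1)[OF jx(2) False]] S(5)[OF jx(2) False] x jx(3)
          by auto
      qed
    qed
    moreover have "card (edges_between ?G (?V \<inter> ?S) (?V - ?S)) \<le> 2 * (k - q)"
    proof -
      have "(rot ^^ i) ` ?V \<subseteq> ?V"
        by auto
      then have img: "(rot ^^ i) ` ?V = ?V"
        using inj finite_triangular_grid[of k]
        by (metis endo_inj_surj inj_on_subset subset_UNIV verts_triangular_grid)
      have "S \<subseteq> ?V"
        using S(1) sector_subset by blast
      then have "?V \<inter> ?S = ?S"
        using img by blast
      moreover have "?V - ?S = (rot ^^ i) ` (?V - S)"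
        using image_set_diff[OF inj, of ?V S] img by simp
      ultimately show ?thesis
        using card_edges_between_funpow_rot[of k i S "?V - S"] card by simp
    qed
    ultimately show "\<exists>S. v \<in> S \<and> ?par v \<notin> S \<and> (\<forall>w\<in>?V - {?r, v}. w \<in> S \<longleftrightarrow> ?par w \<in> S) \<and>
        card (edges_between ?G (?V \<inter> S) (?V - S)) \<le> 2 * (k - q)"
      by (intro exI[of _ ?S] conjI ballI)
  qed
  ultimately show ?thesis
    by blast
qed

section \<open>The exact value for every side length\<close>

lemma spanning_tree_congestion_triangular_grid:
  assumes q: "1 \<le> q" "2 \<le> k" "3 * q \<le> k + 2" "k \<le> 3 * q"
  shows "spanning_tree_congestion (triangular_grid k) = 2 * (k - q)"
proof -
  obtain T where T: "spanning_tree T (triangular_grid k)"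
    "edge_congestion (triangular_grid k) T \<le> 2 * (k - q)"
    using ex_spanning_tree_triangular_grid[OF q] by blast
  \<comment> \<open>The bounds on \<open>q\<close> say that it is \<open>k / 3\<close> rounded up,
    which makes the lower and the upper bound agree.\<close>
  have "(k - 1) div 3 = q - 1"
  proof (rule div_nat_eqI)
    show "3 * (q - 1) \<le> k - 1"
      using q by linarith
    have "Suc (q - 1) = q"
      using q(1) by simp
    then show "k - 1 < 3 * Suc (q - 1)"
      using q by simp
  qed
  then have "2 * (k - 1 - (k - 1) div 3) = 2 * (k - q)"
    using q(1) by simp
  then have "2 * (k - q) \<le> edge_congestion (triangular_grid k) T'"
    if "spanning_tree T' (triangular_grid k)" for T'
    using edge_congestion_triangular_grid_ge[OF q(2) that] by simp
  then show ?thesis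
    by (rule spanning_tree_congestion_eqI[OF finite_triangular_grid finite_edges_triangular_grid T])
qed

theorem theorem2:
  shows "(\<forall>n::nat. n \<ge> 1 \<longrightarrow>
            spanning_tree_congestion (triangular_grid (3 * n)) = 4 * n \<and>
            spanning_tree_congestion (triangular_grid (3 * n + 1)) = 4 * n) \<and>
         (\<forall>n::nat. spanning_tree_congestion (triangular_grid (3 * n + 2)) = 4 * n + 2)"
proof (intro conjI allI impI)
  fix n :: nat assume n: "n \<ge> 1"
  show "spanning_tree_congestion (triangular_grid (3 * n)) = 4 * n"
    using n spanning_tree_congestion_triangular_grid[of n "3 * n"] by simp
  show "spanning_tree_congestion (triangular_grid (3 * n + 1)) = 4 * n"
    using n spanning_tree_congestion_triangular_grid[of "n + 1" "3 * n + 1"] by simp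
next
  fix n :: nat
  show "spanning_tree_congestion (triangular_grid (3 * n + 2)) = 4 * n + 2"
    using spanning_tree_congestion_triangular_grid[of "n + 1" "3 * n + 2"] by simp
qed

end
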